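(* Let $\omega\in\mathcal{D}$ and let $\varphi:[0,1]\to[0,\infty)$ be decreasing such that $\lim_{r\to1^-}\varphi(r)=0$. Then there exists a radial weight $W=W_{\omega,\varphi}$ such that $P_W:L^\infty\to\mathcal{B}$ is not bounded and $\mathcal{B}$ is not continuously embedded into $P_W(L^\infty)$, but $A^p_\omega\subset A^p_W\subset A^p_{\omega\varphi}$ for all $0<p<\infty$. If $\varphi$ satisfies $-\varphi'(t)/\varphi(t)\lesssim1/(1-t)$ for all $0\le t<1$, then $\varphi\omega\in\mathcal{D}$.
   Context: $\mathbb{D}$ is the open unit disc of $\mathbb{C}$, $\mathcal{H}(\mathbb{D})$ the space of analytic functions in $\mathbb{D}$, and $dA(z)=\frac{dx\,dy}{\pi}$. A radial weight is a nonnegative function $\omega\in L^1([0,1))$ extended to $\mathbb{D}$ by $\omega(z)=\omega(|z|)$; it is assumed throughout that $\widehat{\omega}(z)=\int_{|z|}^1\omega(s)\,ds>0$ for all $z\in\mathbb{D}$. $\omega\in\widehat{\mathcal{D}}$ if there is $C\ge1$ with $\widehat{\omega}(r)\le C\widehat{\omega}\left(\frac{1+r}{2}\right)$ for all $0\le r<1$; $\omega\in\check{\mathcal{D}}$ if there are $K>1$ and $C>1$ with $\widehat{\omega}(r)\ge C\widehat{\omega}\left(1-\frac{1-r}{K}\right)$ for all $0\le r<1$; $\mathcal{D}=\widehat{\mathcal{D}}\cap\check{\mathcal{D}}$. $A^p_\omega$ is the space of $f\in\mathcal{H}(\mathbb{D})$ with $\int_{\mathbb{D}}|f(z)|^p\omega(z)\,dA(z)<\infty$;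 $\omega\varphi$ denotes the pointwise product $\omega(|z|)\varphi(|z|)$. With $W_x=\int_0^1r^xW(r)\,dr$ and $B^W_z(\zeta)=\sum_{n=0}^\infty\frac{(\overline{z}\zeta)^n}{2W_{2n+1}}$, the Bergman projection is $P_W(f)(z)=\int_{\mathbb{D}}f(\zeta)\overline{B^W_z(\zeta)}\,W(\zeta)\,dA(\zeta)$. $L^\infty$ is the space of (essentially) bounded measurable functions on $\mathbb{D}$, and the Bloch space $\mathcal{B}$ consists of $f\in\mathcal{H}(\mathbb{D})$ with $\|f\|_{\mathcal{B}}=\sup_{z\in\mathbb{D}}|f'(z)|(1-|z|^2)+|f(0)|<\infty$. "$\mathcal{B}$ is continuously embedded into $P_W(L^\infty)$" means that there is $C>0$ such that for each $f\in\mathcal{B}$ there is $g\in L^\infty$ with $P_W(g)=f$ and $\|g\|_{L^\infty}\le C\|f\|_{\mathcal{B}}$. $a(t)\lesssim b(t)$ means $a(t)\le Cb(t)$ for a constant $C>0$ independent of $t$. *)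

theory Defs
  imports "HOL-Probability.Essential_Supremum" "HOL-Complex_Analysis.Complex_Analysis"
begin

abbreviation unit_disc :: "complex set" where
  "unit_disc \<equiv> ball 0 1"

text \<open>Normalized area measure \<open>dA = dx dy / \<pi>\<close>, living on the unit disc only
  (its space is the disc).\<close>

definition disc_area :: "complex measure" where
  "disc_area = density (lebesgue_on unit_disc) (\<lambda>_. ennreal (1 / pi))"

text \<open>A radial weight is represented by its profile on \<open>[0,1)\<close>; the values of the real function
  elsewhere are never used. At a point \<open>z\<close> of the disc the weight is \<open>\<omega> (norm z)\<close>.\<close>

definition weight_tail :: "(real \<Rightarrow> real) \<Rightarrow> real \<Rightarrow> real" where
  "weight_tail \<omega> r = (LINT s:{r..<1}|lebesgue. \<omega> s)"

definition radial_weight :: "(real \<Rightarrow> real) \<Rightarrow> bool" where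
  "radial_weight \<omega> \<longleftrightarrow>
     set_integrable lebesgue {0..<1} \<omega> \<and>
     (\<forall>r\<in>{0..<1}. \<omega> r \<ge> 0) \<and>
     (\<forall>r\<in>{0..<1}. weight_tail \<omega> r > 0)"

definition D_hat :: "(real \<Rightarrow> real) set" where
  "D_hat = {\<omega>. radial_weight \<omega> \<and>
     (\<exists>C\<ge>1. \<forall>r\<in>{0..<1}. weight_tail \<omega> r \<le> C * weight_tail \<omega> ((1 + r) / 2))}"

definition D_check :: "(real \<Rightarrow> real) set" where
  "D_check = {\<omega>. radial_weight \<omega> \<and>
     (\<exists>K>1. \<exists>C>1. \<forall>r\<in>{0..<1}. weight_tail \<omega> r \<ge> C * weight_tail \<omega> (1 - (1 - r) / K))}"

definition D_class :: "(real \<Rightarrow> real) set" where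
  "D_class = D_hat \<inter> D_check"

text \<open>Membership depends on the values inside the disc only, so inclusions between these sets are
  exactly inclusions between the spaces of functions on the disc.\<close>

definition Bergman_space :: "real \<Rightarrow> (real \<Rightarrow> real) \<Rightarrow> (complex \<Rightarrow> complex) set" where
  "Bergman_space p \<omega> = {f. f holomorphic_on unit_disc \<and>
     integrable disc_area (\<lambda>z. norm (f z) powr p * \<omega> (norm z))}"

definition moment :: "(real \<Rightarrow> real) \<Rightarrow> nat \<Rightarrow> real" where
  "moment W n = (LINT r:{0..<1}|lebesgue. r ^ n * W r)"

definition Bergman_kernel :: "(real \<Rightarrow> real) \<Rightarrow> complex \<Rightarrow> complex \<Rightarrow> complex" where
  "Bergman_kernel W z \<zeta> =
     (\<Sum>n. (cnj z * \<zeta>) ^ n / complex_of_real (2 * moment W (2 * n + 1)))"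

definition Bergman_projection ::
    "(real \<Rightarrow> real) \<Rightarrow> (complex \<Rightarrow> complex) \<Rightarrow> complex \<Rightarrow> complex" where
  "Bergman_projection W f z =
     (LINT \<zeta>|disc_area. f \<zeta> * cnj (Bergman_kernel W z \<zeta>) * complex_of_real (W (norm \<zeta>)))"

definition Linf :: "(complex \<Rightarrow> complex) set" where
  "Linf = {g \<in> borel_measurable disc_area.
     esssup disc_area (\<lambda>z. ereal (norm (g z))) < \<infinity>}"

definition Linf_norm :: "(complex \<Rightarrow> complex) \<Rightarrow> real" where
  "Linf_norm g = real_of_ereal (esssup disc_area (\<lambda>z. ereal (norm (g z))))"

definition Bloch :: "(complex \<Rightarrow> complex) set" where
  "Bloch = {f. f holomorphic_on unit_disc \<and>
     bdd_above ((\<lambda>z. norm (deriv f z) * (1 - (norm z)\<^sup>2)) ` unit_disc)}"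

definition Bloch_norm :: "(complex \<Rightarrow> complex) \<Rightarrow> real" where
  "Bloch_norm f = (SUP z\<in>unit_disc. norm (deriv f z) * (1 - (norm z)\<^sup>2)) + norm (f 0)"

definition projection_bounded :: "(real \<Rightarrow> real) \<Rightarrow> bool" where
  "projection_bounded W \<longleftrightarrow>
     (\<exists>C>0. \<forall>g\<in>Linf. Bergman_projection W g \<in> Bloch \<and>
        Bloch_norm (Bergman_projection W g) \<le> C * Linf_norm g)"

definition Bloch_embedded_in_projection :: "(real \<Rightarrow> real) \<Rightarrow> bool" where
  "Bloch_embedded_in_projection W \<longleftrightarrow>
     (\<exists>C>0. \<forall>f\<in>Bloch. \<exists>g\<in>Linf.
        (\<forall>z\<in>unit_disc. Bergman_projection W g z = f z) \<and>
        Linf_norm g \<le> C * Bloch_norm f)"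

end

theory Submission
  imports Defs "HOL-Probability.Distribution_Functions"
begin

text \<open>
  The weight is \<open>W = (1\<^sub>E + \<phi>) \<omega>\<close>, where \<open>E\<close> is a union of annuli of bounded hyperbolic width that are
  extremely far apart; then \<open>\<phi> \<omega> \<le> W \<le> (1 + \<phi>(0)) \<omega>\<close>, which gives the inclusions of Bergman spaces.
  Write \<open>W\<^sub>x\<close> for the moments of \<open>W\<close>.

  If \<open>P\<^sub>W\<close> is bounded, then testing on \<open>(z/|z|)\<^sup>N\<close>, whose projection is \<open>(W\<^bsub>N+1\<^esub>/W\<^bsub>2N+1\<^esub>) z\<^sup>N\<close>, gives
  \<open>W\<^bsub>N+1\<^esub> \<lesssim> W\<^bsub>2N+1\<^esub>\<close>. This fails when \<open>N\<close> is large compared with the reciprocal distance of an annulus to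
  the circle, because behind the annulus \<open>W\<close> is only \<open>\<phi> \<omega>\<close> for a very long stretch.

  If the Bloch space embeds into \<open>P\<^sub>W(L\<^sup>\<infinity>)\<close>, write the lacunary polynomial \<open>f = \<Sum> z\<^bsup>2^k\<^esup>\<close>,
  \<open>m < k \<le> m + n\<close>, whose Bloch norm is at most \<open>4\<close>, as \<open>P\<^sub>W g\<close>. Pairing \<open>g\<close> with \<open>f\<close> gives the sum of \<open>n\<close>
  moments, while the \<open>A\<^sup>1\<^sub>W\<close> norm of \<open>f\<close> is only of size \<open>\<surd>n W\<^bsub>2^(m+1)+1\<^esub>\<close> by orthogonality. So \<open>W\<close> would have
  to lose a factor \<open>\<surd>n\<close> between the moments of order \<open>2\<^sup>m\<close> and \<open>2\<^bsup>m+n\<^esup>\<close>, which fails just before an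
  annulus: there the mass of the annulus dominates both moments.
\<close>

section \<open>Rotation invariance and polar integration on the disc\<close>

text \<open>The projection enters only through its Taylor coefficients, so both failures become
  statements about the decay of the moments of W; of the kernel nothing but the absolute convergence
  of its series is used. Radii are taken on the dyadic scale 1 - 2^-k. Upper doubling says that the
  tail of \<omega> loses at most a factor C per step, lower doubling that it shrinks at least to the
  fraction q in l steps. The latter fixes the width of an annulus: l steps, so that it holds the
  share 1 - q of the tail from its inner radius. The former ties the moment of order 2^k to the tail
  from the k-th radius. Every gap between annuli serves twice, its beginning against boundedness and
  its end against the embedding. The obstacle is that both arguments need windows whose length grows
  with j, over which losses such as C^j and 4^(2^(l+j)) pile up. Hence annulus j is placed only
  where \<phi> has dropped below a threshold that absorbs these losses, and the next one only where
  the remaining tail is tiny and where the moments in question no longer see anything inside the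
  gap.\<close>

lemma emeasure_lborel_translate_vimage:
  fixes c :: real
  assumes "B \<in> sets borel"
  shows "emeasure lborel ((\<lambda>x. x + c) -` B) = emeasure lborel B"
proof -
  have "emeasure lborel B = emeasure (distr lborel borel ((+) c)) B"
    by (simp add: lborel_distr_plus)
  also have "\<dots> = emeasure lborel ((+) c -` B)"
    using assms by (subst emeasure_distr) auto
  also have "(+) c -` B = (\<lambda>x. x + c) -` B"
    by (simp add: vimage_def add.commute)
  finally show ?thesis ..
qed

lemma vimage_Pair_borel:
  fixes A :: "(real \<times> real) set"
  assumes "A \<in> sets borel"
  shows "(\<lambda>x. (x, y)) -` A \<in> sets borel" "Pair x -` A \<in> sets borel"
proof -
  have 1: "(\<lambda>x. (x, y)) \<in> measurable borel borel" and 2: "Pair x \<in> measurable borel borel"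
    by (auto intro!: borel_measurable_continuous_onI continuous_intros)
  show "(\<lambda>x. (x, y)) -` A \<in> sets borel" "Pair x -` A \<in> sets borel"
    using measurable_sets[OF 1 assms] measurable_sets[OF 2 assms] by auto
qed

text \<open>Fubini: on each horizontal line the shear is a translation.\<close>

lemma distr_lborel_shear1:
  "distr lborel borel (\<lambda>(x, y). (x + t * y, y)) = (lborel :: (real \<times> real) measure)"
proof (rule measure_eqI)
  fix A :: "(real \<times> real) set"
  let ?S = "\<lambda>(x, y). (x + t * y, y)"
  assume "A \<in> sets (distr lborel borel ?S)"
  then have A: "A \<in> sets borel" by simp
  have S: "?S \<in> borel_measurable borel"
    by (auto intro!: borel_measurable_continuous_onI continuous_intros simp: case_prod_unfold)
  have A': "?S -` A \<in> sets borel"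
    using measurable_sets[OF S A] by auto
  have prod: "emeasure lborel B = (\<integral>\<^sup>+y. emeasure lborel ((\<lambda>x. (x, y)) -` B) \<partial>lborel)"
    if "B \<in> sets borel" for B :: "(real \<times> real) set"
    using that by (subst lborel_prod[symmetric], intro lborel_pair.emeasure_pair_measure_alt2)
      (simp only: lborel_prod sets_lborel)
  have "emeasure (distr lborel borel ?S) A = emeasure lborel (?S -` A)"
    using A S by (subst emeasure_distr) auto
  also have "\<dots> = (\<integral>\<^sup>+y. emeasure lborel ((\<lambda>x. (x, y)) -` (?S -` A)) \<partial>lborel)"
    by (rule prod[OF A'])
  also have "\<dots> = (\<integral>\<^sup>+y. emeasure lborel ((\<lambda>x. (x, y)) -` A) \<partial>lborel)"
  proof (rule nn_integral_cong)
    fix y :: real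
    have "(\<lambda>x. (x, y)) -` (?S -` A) = (\<lambda>x. x + t * y) -` ((\<lambda>x. (x, y)) -` A)"
      by auto
    then show "emeasure lborel ((\<lambda>x. (x, y)) -` (?S -` A)) = emeasure lborel ((\<lambda>x. (x, y)) -` A)"
      using emeasure_lborel_translate_vimage[OF vimage_Pair_borel(1)[OF A]] by simp
  qed
  also have "\<dots> = emeasure lborel A"
    by (rule prod[OF A, symmetric])
  finally show "emeasure (distr lborel borel ?S) A = emeasure lborel A" .
qed simp

lemma distr_lborel_shear2:
  "distr lborel borel (\<lambda>(x, y). (x, y + t * x)) = (lborel :: (real \<times> real) measure)"
proof (rule measure_eqI)
  fix A :: "(real \<times> real) set"
  let ?S = "\<lambda>(x, y). (x, y + t * x)"
  assume "A \<in> sets (distr lborel borel ?S)"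
  then have A: "A \<in> sets borel" by simp
  have S: "?S \<in> borel_measurable borel"
    by (auto intro!: borel_measurable_continuous_onI continuous_intros simp: case_prod_unfold)
  have A': "?S -` A \<in> sets borel"
    using measurable_sets[OF S A] by auto
  have prod: "emeasure lborel B = (\<integral>\<^sup>+x. emeasure lborel (Pair x -` B) \<partial>lborel)"
    if "B \<in> sets borel" for B :: "(real \<times> real) set"
    using that by (subst lborel_prod[symmetric], intro lborel.emeasure_pair_measure_alt)
      (simp only: lborel_prod sets_lborel)
  have "emeasure (distr lborel borel ?S) A = emeasure lborel (?S -` A)"
    using A S by (subst emeasure_distr) auto
  also have "\<dots> = (\<integral>\<^sup>+x. emeasure lborel (Pair x -` (?S -` A)) \<partial>lborel)"
    by (rule prod[OF A'])
  also have "\<dots> = (\<integral>\<^sup>+x. emeasure lborel (Pair x -` A) \<partial>lborel)"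
  proof (rule nn_integral_cong)
    fix x :: real
    have "Pair x -` (?S -` A) = (\<lambda>y. y + t * x) -` (Pair x -` A)"
      by auto
    then show "emeasure lborel (Pair x -` (?S -` A)) = emeasure lborel (Pair x -` A)"
      using emeasure_lborel_translate_vimage[OF vimage_Pair_borel(2)[OF A]] by simp
  qed
  also have "\<dots> = emeasure lborel A"
    by (rule prod[OF A, symmetric])
  finally show "emeasure (distr lborel borel ?S) A = emeasure lborel A" .
qed simp

lemma borel_measurable_Complex_pair:
  "(\<lambda>(x, y). Complex x y) \<in> borel_measurable borel"
  by (auto intro!: borel_measurable_continuous_onI continuous_intros simp: case_prod_unfold)

lemma distr_lborel_Complex:
  "distr lborel borel (\<lambda>(x, y). Complex x y) = lborel"
proof (rule lborel_eqI[symmetric])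
  fix l u :: complex
  assume le: "\<And>b. b \<in> Basis \<Longrightarrow> l \<bullet> b \<le> u \<bullet> b"
  have "(\<lambda>(x, y). Complex x y) -` box l u = box (Re l, Im l) (Re u, Im u)"
    by (auto simp: box_def Basis_complex_def Basis_prod_def inner_complex_def)
  then show "emeasure (distr lborel borel (\<lambda>(x, y). Complex x y)) (box l u)
      = ennreal (\<Prod>b\<in>Basis. (u - l) \<bullet> b)"
    using borel_measurable_Complex_pair le[of 1] le[of \<i>]
    by (subst emeasure_distr)
       (auto simp: emeasure_lborel_box_eq Basis_complex_def Basis_prod_def inner_complex_def prod.union_disjoint
         prod.insert_if)
qed simp

text \<open>A rotation with non-real angle factor is a product of three shears.\<close>

lemma distr_lborel_rotation:
  fixes c :: complex
  assumes "norm c = 1" "Im c \<noteq> 0"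
  shows "distr lborel borel ((*) c) = lborel"
proof -
  \<comment> \<open>For c = e^(i t) this is -tan(t/2), the parameter of the two outer shears; the
    middle one has parameter sin t.\<close>
  define a where "a = (Re c - 1) / Im c"
  let ?S = "\<lambda>(x::real, y::real). (x + a * y, y)" and ?R = "\<lambda>(x::real, y::real). (x, y + Im c * x)"
    and ?C = "\<lambda>(x, y). Complex x y"
  have S: "?S \<in> borel_measurable borel" and R: "?R \<in> borel_measurable borel"
    by (auto intro!: borel_measurable_continuous_onI continuous_intros simp: case_prod_unfold)
  have c: "Re c * Re c + Im c * Im c = 1"
    using assms(1) by (metis cmod_power2 one_power2 power2_eq_square)
  have 1: "1 + a * Im c = Re c"
    using assms(2) by (simp add: a_def)
  have 2: "a + a * (Im c * a + 1) = - Im c"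
  proof -
    have "a + a * (Im c * a + 1) = a * (Re c + 1)"
      using 1 by (simp add: algebra_simps)
    also have "\<dots> * Im c = (Re c * Re c - 1)"
    proof -
      have "a * Im c = Re c - 1"
        using assms(2) by (simp add: a_def)
      then have "a * (Re c + 1) * Im c = (Re c - 1) * (Re c + 1)"
        by (metis mult.assoc mult.commute)
      then show ?thesis by (simp add: algebra_simps)
    qed
    also have "\<dots> = - Im c * Im c"
      using c by simp
    finally show ?thesis
      using assms(2) by (metis mult_cancel_right mult_minus_left)
  qed
  have "c * ?C p = ?C (?S (?R (?S p)))" for p
  proof (cases p)
    case (Pair x y)
    have "Re c * x - Im c * y = x + a * y + a * (y + Im c * (x + a * y))"
    proof -
      have "x + a * y + a * (y + Im c * (x + a * y)) = (1 + a * Im c) * x + (a + a * (Im c * a + 1)) * y"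
        by (simp add: algebra_simps)
      then show ?thesis unfolding 1 2 by simp
    qed
    moreover have "Im c * x + Re c * y = y + Im c * (x + a * y)"
      unfolding 1[symmetric] by (simp add: algebra_simps)
    ultimately show ?thesis
      using Pair by (simp add: complex_eq_iff)
  qed
  then have eq: "(*) c \<circ> ?C = ?C \<circ> (?S \<circ> (?R \<circ> ?S))"
    by auto
  have C: "?C \<in> borel_measurable borel" by (rule borel_measurable_Complex_pair)
  have "distr lborel borel ((*) c) = distr (distr lborel borel ?C) borel ((*) c)"
    by (simp add: distr_lborel_Complex)
  also have "\<dots> = distr lborel borel ((*) c \<circ> ?C)"
    using C by (subst distr_distr) auto
  also have "\<dots> = distr (distr (distr (distr lborel borel ?S) borel ?R) borel ?S) borel ?C"
    unfolding eq using C S R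
    by (simp add: distr_distr measurable_comp[OF S R] measurable_comp[OF measurable_comp[OF S R] S] comp_assoc)
  also have "\<dots> = lborel"
    unfolding distr_lborel_shear1 distr_lborel_shear2 distr_lborel_Complex ..
  finally show ?thesis .
qed

section \<open>Area of the disc and the distribution of the modulus\<close>

lemma
  shows sets_disc_area: "sets disc_area = sets (lebesgue_on unit_disc)"
    and space_disc_area: "space disc_area = unit_disc"
  by (simp_all add: disc_area_def)

lemma borel_measurable_disc_area_iff:
  "f \<in> borel_measurable disc_area \<longleftrightarrow> f \<in> borel_measurable (lebesgue_on unit_disc)"
  by (simp add: disc_area_def)

lemma borel_measurable_disc_area:
  "f \<in> borel_measurable borel \<Longrightarrow> f \<in> borel_measurable disc_area"
  unfolding borel_measurable_disc_area_iff
  by (intro measurable_restrict_space1 measurable_completion) simp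

lemma disc_area_density_lebesgue:
  "emeasure disc_area A = ennreal (1 / pi) * emeasure lebesgue A" if "A \<in> sets disc_area"
proof -
  from that have A: "A \<in> sets (lebesgue_on unit_disc)" by (simp add: disc_area_def)
  have "emeasure disc_area A = ennreal (1/pi) * emeasure (lebesgue_on unit_disc) A"
    unfolding disc_area_def using A by (simp add: emeasure_density nn_integral_cmult_indicator)
  also have "emeasure (lebesgue_on unit_disc) A = emeasure lebesgue A"
    using A by (subst emeasure_restrict_space) (auto simp: sets_restrict_space)
  finally show ?thesis .
qed

lemma emeasure_disc_area_ball:
  assumes "0 \<le> r" "r \<le> 1"
  shows "emeasure disc_area (ball 0 r) = ennreal (r\<^sup>2)" "emeasure disc_area (cball 0 r \<inter> unit_disc) = ennreal (r\<^sup>2)"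
proof -
  have 1: "emeasure disc_area (ball 0 r) = ennreal (r\<^sup>2)" if "0 \<le> r" "r \<le> 1" for r
  proof -
    have "ball 0 r \<in> sets disc_area"
      using that by (auto simp: sets_disc_area sets_restrict_space_iff)
    then have "emeasure disc_area (ball 0 r) = ennreal (1/pi) * ennreal (pi * r\<^sup>2)"
      using that by (simp add: disc_area_density_lebesgue emeasure_ball unit_ball_vol_2)
    then show ?thesis
      by (simp add: ennreal_mult[symmetric])
  qed
  then show "emeasure disc_area (ball 0 r) = ennreal (r\<^sup>2)"
    using assms by blast
  show "emeasure disc_area (cball 0 r \<inter> unit_disc) = ennreal (r\<^sup>2)"
  proof (cases "r = 1")
    case True
    then show ?thesis using 1[of r] by (simp add: Int_absorb1 ball_subset_cball)
  next
    case False
    with assms have "cball 0 r \<inter> unit_disc = (cball 0 r :: complex set)"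
      by auto
    moreover from this have "cball (0::complex) r \<in> sets disc_area"
      by (auto simp: sets_disc_area sets_restrict_space_iff)
    then have "emeasure disc_area (cball 0 r) = ennreal (1/pi) * ennreal (pi * r\<^sup>2)"
      using assms by (simp add: disc_area_density_lebesgue emeasure_cball unit_ball_vol_2)
    then have "emeasure disc_area (cball 0 r) = ennreal (r\<^sup>2)"
      by (simp add: ennreal_mult[symmetric])
    ultimately show ?thesis by simp
  qed
qed

lemma emeasure_disc_area_space: "emeasure disc_area unit_disc = 1"
  using emeasure_disc_area_ball(1)[of 1] by simp

text \<open>Polar coordinates for radial functions without a change of variables: finite measures on
  the line that agree on all half-lines \<open>{x<..}\<close> are equal, and there only the areas of
  discs are needed.\<close>

lemma distr_disc_area_norm:
  "distr disc_area borel norm = density lborel (\<lambda>r. ennreal (2 * r) * indicator {0..<1} r)"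
proof (rule measure_eqI_lessThan)
  have M: "norm \<in> borel_measurable disc_area"
    by (rule borel_measurable_disc_area) simp
  have val: "emeasure (distr disc_area borel norm) {x<..} = ennreal (1 - (max 0 x)\<^sup>2)" if "x \<le> 1" for x
  proof -
    have "emeasure (distr disc_area borel norm) {x<..} = emeasure disc_area (norm -` {x<..} \<inter> unit_disc)"
      using M by (subst emeasure_distr) (auto simp: space_disc_area)
    also have "\<dots> = ennreal (1 - (max 0 x)\<^sup>2)"
    proof (cases "x < 0")
      case True
      then have "norm -` {x<..} \<inter> unit_disc = unit_disc"
        by (auto intro: less_le_trans[OF _ norm_ge_zero])
      then show ?thesis using True emeasure_disc_area_space by (simp add: max_def)
    next
      case False
      have eq: "norm -` {x<..} \<inter> unit_disc = unit_disc - (cball 0 x \<inter> unit_disc)"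
        by auto
      have "emeasure disc_area (unit_disc - (cball 0 x \<inter> unit_disc)) = 1 - ennreal (x\<^sup>2)"
        using False that
        by (subst emeasure_Diff)
           (auto simp: emeasure_disc_area_ball emeasure_disc_area_space sets_disc_area sets_restrict_space_iff)
      then show ?thesis
        using False by (simp add: eq max_def ennreal_minus flip: ennreal_1)
    qed
    finally show ?thesis .
  qed
  have val1: "emeasure (distr disc_area borel norm) {x<..} = 0" if "x > 1" for x
  proof -
    have "norm -` {x<..} \<inter> unit_disc = {}" using that by auto
    then show ?thesis
      using M by (subst emeasure_distr) (auto simp: space_disc_area)
  qed
  show "emeasure (distr disc_area borel norm) {x<..} < \<infinity>" for x
    using val[of x] val1[of x] by (cases "x \<le> 1") auto
  show "emeasure (distr disc_area borel norm) {x<..}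
      = emeasure (density lborel (\<lambda>r. ennreal (2 * r) * indicator {0..<1} r)) {x<..}" for x :: real
  proof (cases "x \<le> 1")
    case True
    have "emeasure (density lborel (\<lambda>r. ennreal (2 * r) * indicator {0..<1} r)) {x<..}
       = (\<integral>\<^sup>+r. ennreal (2 * r) * indicator {0..<1} r * indicator {x<..} r \<partial>lborel)"
      by (subst emeasure_density) auto
    also have "\<dots> = (\<integral>\<^sup>+r. ennreal (2 * r) * indicator {max 0 x .. 1} r \<partial>lborel)"
    proof (rule nn_integral_cong_AE)
      have "AE r in lborel. r \<noteq> x \<and> r \<noteq> 1"
        using AE_lborel_singleton[of x] AE_lborel_singleton[of 1] by auto
      then show "AE r in lborel. ennreal (2 * r) * indicator {0..<1} r * indicator {x<..} r =
          ennreal (2 * r) * indicator {max 0 x .. 1} r"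
        by eventually_elim (auto simp: indicator_def)
    qed
    also have "\<dots> = 1\<^sup>2 - (max 0 x)\<^sup>2"
      using True by (intro nn_integral_FTC_Icc) (auto intro!: derivative_eq_intros)
    finally show ?thesis using val[OF True] by simp
  next
    case False
    have "emeasure (density lborel (\<lambda>r. ennreal (2 * r) * indicator {0..<1} r)) {x<..}
       = (\<integral>\<^sup>+r. ennreal (2 * r) * indicator {0..<1} r * indicator {x<..} r \<partial>lborel)"
      by (subst emeasure_density) auto
    also have "\<dots> = (\<integral>\<^sup>+r. 0 \<partial>(lborel :: real measure))"
      by (rule nn_integral_cong) (use False in \<open>auto simp: indicator_def\<close>)
    finally show ?thesis using False val1 by simp
  qed
qed auto

text \<open>The law of the modulus has a density, so it does not charge null sets. This is what
  makes \<open>w (norm z)\<close> Lebesgue measurable when \<open>w\<close> is only Lebesgue, not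
  Borel, measurable.\<close>

lemma null_sets_vimage_norm:
  assumes "N \<in> null_sets lborel"
  shows "norm -` N \<inter> unit_disc \<in> null_sets (lebesgue :: complex measure)"
proof -
  have N: "N \<in> sets borel" using assms by auto
  have M: "norm \<in> borel_measurable disc_area" by (rule borel_measurable_disc_area) simp
  have "AE r in lborel. r \<notin> N"
    using assms by (rule AE_not_in)
  then have "(\<integral>\<^sup>+r. ennreal (2 * r) * indicator {0..<1} r * indicator N r \<partial>lborel) = (\<integral>\<^sup>+r. 0 \<partial>(lborel::real measure))"
    by (intro nn_integral_cong_AE, eventually_elim) auto
  then have 0: "emeasure (distr disc_area borel norm) N = 0"
    using N unfolding distr_disc_area_norm by (subst emeasure_density) auto
  have sets: "norm -` N \<inter> unit_disc \<in> sets disc_area"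
    using measurable_sets[OF M N] by (simp add: space_disc_area)
  have "emeasure disc_area (norm -` N \<inter> unit_disc) = 0"
    using 0 M N by (subst (asm) emeasure_distr) (auto simp: space_disc_area)
  then have "emeasure lebesgue (norm -` N \<inter> unit_disc) = 0"
    using disc_area_density_lebesgue[OF sets] by simp
  moreover have "norm -` N \<inter> unit_disc \<in> sets lebesgue"
    using sets by (simp add: sets_disc_area sets_restrict_space_iff)
  ultimately show ?thesis by (simp add: null_sets_def)
qed

lemma
  fixes w :: "real \<Rightarrow> real"
  assumes w: "set_borel_measurable lebesgue {0..<1} w"
  shows borel_measurable_radial: "(\<lambda>z. w (norm z)) \<in> borel_measurable disc_area"
    and integrable_radial_iff: "integrable disc_area (\<lambda>z. w (norm z)) \<longleftrightarrow> set_integrable lebesgue {0..<1} (\<lambda>r. 2 * r * w r)"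
    and radial_eq_borel_AE: "\<exists>h\<in>borel_measurable borel. AE z in disc_area. w (norm z) = h (norm z)"
    and integral_radial: "(LINT z|disc_area. w (norm z)) = (LINT r:{0..<1}|lebesgue. 2 * r * w r)"
proof -
  define v where "v r = indicator {0..<1} r * w r" for r :: real
  have v: "v \<in> borel_measurable (completion lborel)"
    using w by (simp add: set_borel_measurable_def v_def[abs_def])
  \<comment> \<open>Transport of integrals along \<open>norm\<close> works for Borel functions, so
    the profile is replaced by a Borel one; the exceptional set stays null after pulling back to the
    disc.\<close>
  obtain h where h [measurable]: "h \<in> borel_measurable lborel" and hv: "AE r in lborel. v r = h r"
    using completion_ex_borel_measurable_real[OF v] by blast
  then obtain N where N: "{r. v r \<noteq> h r} \<subseteq> N" "N \<in> null_sets lborel"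
    by (auto elim!: AE_E simp: null_sets_def)
  have h' [measurable]: "h \<in> borel_measurable borel" using h by simp
  have Nz: "norm -` N \<inter> unit_disc \<in> null_sets (lebesgue :: complex measure)"
    by (rule null_sets_vimage_norm) (use N in auto)
  then have AEz: "AE z in (lebesgue :: complex measure). z \<notin> norm -` N \<inter> unit_disc"
    by (rule AE_not_in)
  have "(\<lambda>z. indicator unit_disc z * h (norm z)) \<in> borel_measurable (lebesgue :: complex measure)"
  proof (intro measurable_completion)
    have "(\<lambda>z::complex. h (norm z)) \<in> borel_measurable borel"
      using h' by (rule measurable_compose[OF borel_measurable_norm])
    then show "(\<lambda>z. indicator unit_disc z * h (norm z)) \<in> borel_measurable (lborel :: complex measure)"
      by (auto intro!: borel_measurable_times borel_measurable_indicator)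
  qed
  moreover have "AE z in (lebesgue :: complex measure). indicator unit_disc z * h (norm z) = indicator unit_disc z * w (norm z)"
    using AEz
  proof eventually_elim
    case (elim z)
    then have "v (norm z) = h (norm z)" if "z \<in> unit_disc" using N(1) that by blast
    then show ?case by (cases "z \<in> unit_disc") (auto simp: v_def)
  qed
  ultimately have "(\<lambda>z. indicator unit_disc z * w (norm z)) \<in> borel_measurable (lebesgue :: complex measure)"
    by (rule borel_measurable_AE)
  then show wm: "(\<lambda>z. w (norm z)) \<in> borel_measurable disc_area"
    unfolding borel_measurable_disc_area_iff
    by (subst borel_measurable_restrict_space_iff) auto
  have AEd: "AE z in disc_area. w (norm z) = h (norm z)"
  proof -
    have "AE z in lebesgue_on unit_disc. w (norm z) = h (norm z)"
    proof (subst AE_restrict_space_iff)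
      show "AE z in lebesgue. z \<in> unit_disc \<longrightarrow> w (norm z) = h (norm z)"
        using AEz
      proof eventually_elim
        case (elim z)
        then have "v (norm z) = h (norm z)" if "z \<in> unit_disc" using N(1) that by blast
        then show ?case by (auto simp: v_def)
      qed
    qed auto
    then show ?thesis
      unfolding disc_area_def by (subst AE_density) (auto)
  qed
  then show "\<exists>h\<in>borel_measurable borel. AE z in disc_area. w (norm z) = h (norm z)"
    using h' by blast
  have hm: "(\<lambda>z. h (norm z)) \<in> borel_measurable disc_area" 
    by (rule borel_measurable_disc_area measurable_compose[OF borel_measurable_norm] h')+
  have nm: "norm \<in> borel_measurable disc_area" by (rule borel_measurable_disc_area) simp
  define k where "k r = 2 * r * indicator {0..<1} r" for r :: real
  have k: "density lborel (\<lambda>r. ennreal (2 * r) * indicator {0..<1} r) = density lborel (\<lambda>r. ennreal (k r))"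
    by (intro density_cong AE_I2) (auto simp: k_def indicator_def)
  have k_meas: "k \<in> borel_measurable borel"
    unfolding k_def by measurable
  have k_pos: "k r \<ge> 0" for r by (auto simp: k_def indicator_def)
  have AEl: "AE r in lebesgue. indicator {0..<1} r *\<^sub>R (2 * r * w r) = k r *\<^sub>R h r"
    using AE_completion[OF hv] by eventually_elim (auto simp: k_def v_def indicator_def)
  have lm: "(\<lambda>r. indicator {0..<1} r *\<^sub>R (2 * r * w r)) \<in> borel_measurable lebesgue"
  proof -
    have "(\<lambda>r. 2 * r * v r) \<in> borel_measurable lebesgue"
      using v by (intro borel_measurable_times) (auto intro!: measurable_completion)
    then show ?thesis by (simp add: v_def mult_ac)
  qed
  have km: "(\<lambda>r. k r *\<^sub>R h r) \<in> borel_measurable lborel"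
    using k_meas by measurable
  have "integrable disc_area (\<lambda>z. w (norm z)) \<longleftrightarrow> integrable disc_area (\<lambda>z. h (norm z))"
    using AEd by (rule integrable_cong_AE[OF wm hm])
  also have "\<dots> \<longleftrightarrow> integrable (distr disc_area borel norm) h"
    using nm by (simp add: integrable_distr_eq)
  also have "\<dots> \<longleftrightarrow> integrable lborel (\<lambda>r. k r *\<^sub>R h r)"
    unfolding distr_disc_area_norm k using k_meas k_pos by (subst integrable_density) auto
  also have "\<dots> \<longleftrightarrow> integrable lebesgue (\<lambda>r. k r *\<^sub>R h r)"
    using km by (rule integrable_completion[symmetric])
  also have "\<dots> \<longleftrightarrow> integrable lebesgue (\<lambda>r. indicator {0..<1} r *\<^sub>R (2 * r * w r))"
    using AEl lm km by (intro integrable_cong_AE) (auto intro!: measurable_completion)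
  finally show "integrable disc_area (\<lambda>z. w (norm z)) \<longleftrightarrow> set_integrable lebesgue {0..<1} (\<lambda>r. 2 * r * w r)"
    by (simp add: set_integrable_def)
  have "(LINT z|disc_area. w (norm z)) = (LINT z|disc_area. h (norm z))"
    using AEd by (rule integral_cong_AE[OF wm hm])
  also have "\<dots> = (LINT r|distr disc_area borel norm. h r)"
    using nm by (subst integral_distr) auto
  also have "\<dots> = (LINT r|lborel. k r *\<^sub>R h r)"
    unfolding distr_disc_area_norm k using k_meas k_pos by (subst integral_density) auto
  also have "\<dots> = (LINT r|lebesgue. k r *\<^sub>R h r)"
    using km by (rule integral_completion[symmetric])
  also have "\<dots> = (LINT r|lebesgue. indicator {0..<1} r *\<^sub>R (2 * r * w r))"
    using AEl lm km by (intro integral_cong_AE) (auto intro!: measurable_completion)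
  finally show "(LINT z|disc_area. w (norm z)) = (LINT r:{0..<1}|lebesgue. 2 * r * w r)"
    by (simp add: set_lebesgue_integral_def)
qed

section \<open>Rotations of the disc and orthogonality of monomials\<close>

lemma integral_disc_area:
  fixes f :: "complex \<Rightarrow> complex"
  assumes "f \<in> borel_measurable disc_area"
  shows "(LINT z|disc_area. f z) = (LINT z|lebesgue. (indicator unit_disc z / pi) *\<^sub>R f z)"
proof -
  have "(LINT z|disc_area. f z) = (LINT z|lebesgue_on unit_disc. (1 / pi) *\<^sub>R f z)"
    using assms unfolding disc_area_def borel_measurable_disc_area_iff
    by (subst integral_density) (auto simp: disc_area_def)
  also have "\<dots> = (LINT z|lebesgue. (indicator unit_disc z / pi) *\<^sub>R f z)"
    by (subst integral_restrict_space) auto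
  finally show ?thesis .
qed

lemma integral_disc_area_rotation:
  fixes f :: "complex \<Rightarrow> complex"
  assumes f: "f \<in> borel_measurable borel" and c: "norm c = 1" "Im c \<noteq> 0"
  shows "(LINT z|disc_area. f (c * z)) = (LINT z|disc_area. f z)"
proof -
  define F where "F z = (indicator unit_disc z / pi) *\<^sub>R f z" for z
  have F: "F \<in> borel_measurable borel"
    unfolding F_def using f
    by (intro borel_measurable_scaleR borel_measurable_divide borel_measurable_indicator) auto
  have fc: "(\<lambda>z. f (c * z)) \<in> borel_measurable borel"
    by (rule measurable_compose[OF _ f]) simp
  have eq: "(\<lambda>z. (indicator unit_disc z / pi) *\<^sub>R f (c * z)) = (\<lambda>z. F (c * z))"
    using c by (auto simp: F_def indicator_def norm_mult)
  have Fc: "(\<lambda>z. F (c * z)) \<in> borel_measurable borel"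
    by (rule measurable_compose[OF _ F]) simp
  have "(LINT z|disc_area. f (c * z)) = (LINT z|lborel. F (c * z))"
    using fc Fc by (simp add: integral_disc_area borel_measurable_disc_area eq integral_completion)
  also have "\<dots> = (LINT z|distr lborel borel ((*) c). F z)"
    using F by (subst integral_distr) auto
  also have "\<dots> = (LINT z|lborel. F z)"
    by (simp add: distr_lborel_rotation[OF c])
  also have "\<dots> = (LINT z|disc_area. f z)"
    using f F by (simp add: integral_disc_area borel_measurable_disc_area F_def[symmetric] integral_completion)
  finally show ?thesis .
qed

text \<open>Rotating by pi / (2 |a - b|) turns z^a times the conjugate of z^b by a quarter turn, so
  the factor is i or -i. The angle lies strictly between 0 and pi, which keeps c non-real as the
  shear decomposition demands.\<close>

lemma cis_power_neq_1:
  assumes "a \<noteq> (b::nat)"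
  obtains c where "norm c = 1" "Im c \<noteq> 0" "c ^ a * cnj c ^ b \<noteq> 1"
proof -
  define d where "d = max a b - min a b"
  define c where "c = cis (pi / (2 * real d))"
  have d: "d > 0" using assms by (auto simp: d_def)
  have "pi / (2 * real d) < pi"
    using d by (simp add: field_simps)
  then have "Im c > 0"
    using d by (auto simp: c_def intro!: sin_gt_zero divide_pos_pos)
  have cc: "c * cnj c = 1" and cc': "cnj c * c = 1" by (simp_all add: c_def cis_cnj cis_mult)
  have cd: "c ^ d = \<i>"
  proof -
    have "real d * (pi / (2 * real d)) = pi / 2" using d by simp
    then show ?thesis using d unfolding c_def by (simp add: Complex.DeMoivre)
  qed
  have "c ^ a * cnj c ^ b \<noteq> 1"
  proof (cases "a \<ge> b")
    case True
    then have "a = d + b" using assms by (auto simp: d_def)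
    then have "c ^ a * cnj c ^ b = c ^ d * (c * cnj c) ^ b"
      by (simp add: power_add power_mult_distrib)
    then show ?thesis using cd cc by simp
  next
    case False
    then have "b = d + a" using assms by (auto simp: d_def)
    then have "c ^ a * cnj c ^ b = cnj (c ^ d) * (c * cnj c) ^ a"
      by (simp add: power_add power_mult_distrib)
    then show ?thesis using cd cc by (simp add: complex_eq_iff)
  qed
  with \<open>Im c > 0\<close> show ?thesis by (intro that[of c]) (auto simp: c_def)
qed

lemma borel_measurable_complex_of_real:
  "f \<in> borel_measurable M \<Longrightarrow> (\<lambda>x. complex_of_real (f x)) \<in> borel_measurable M"
  by simp

text \<open>A rotation by c preserves the integral and multiplies it by
  \<open>c ^ a * cnj c ^ b\<close>, which is not 1.\<close>

lemma integral_monomial_radial_eq_0: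
  fixes w :: "real \<Rightarrow> real"
  assumes w: "set_borel_measurable lebesgue {0..<1} w" and ab: "a \<noteq> b"
  shows "(LINT z|disc_area. z ^ a * cnj z ^ b * of_real (w (norm z))) = 0"
proof -
  obtain h where h: "h \<in> borel_measurable borel" and ae: "AE z in disc_area. w (norm z) = h (norm z)"
    using radial_eq_borel_AE[OF w] by blast
  define f where "f z = z ^ a * cnj z ^ b * of_real (h (norm z))" for z :: complex
  have hm: "(\<lambda>z::complex. h (norm z)) \<in> borel_measurable borel"
    using h by (rule measurable_compose[OF borel_measurable_norm])
  have zm: "(\<lambda>z. z ^ a * cnj z ^ b) \<in> borel_measurable borel"
    by (intro borel_measurable_continuous_onI continuous_intros)
  have f: "f \<in> borel_measurable borel"
    unfolding f_def by (rule borel_measurable_times[OF zm borel_measurable_complex_of_real[OF hm]])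
  have wm: "(\<lambda>z. w (norm z)) \<in> borel_measurable disc_area"
    by (rule borel_measurable_radial[OF w])
  obtain c where c: "norm c = 1" "Im c \<noteq> 0" "c ^ a * cnj c ^ b \<noteq> 1"
    using cis_power_neq_1[OF ab] .
  have "(LINT z|disc_area. f z) = (LINT z|disc_area. f (c * z))"
    by (rule integral_disc_area_rotation[OF f c(1,2), symmetric])
  also have "\<dots> = (LINT z|disc_area. (c ^ a * cnj c ^ b) * f z)"
    using c(1) by (simp add: f_def norm_mult power_mult_distrib mult_ac)
  also have "\<dots> = (c ^ a * cnj c ^ b) * (LINT z|disc_area. f z)"
    by simp
  finally have "(LINT z|disc_area. f z) = 0"
    using c(3) by (metis mult_cancel_right1 mult.commute)
  moreover have "(LINT z|disc_area. z ^ a * cnj z ^ b * of_real (w (norm z))) = (LINT z|disc_area. f z)"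
  proof (rule integral_cong_AE)
    show "(\<lambda>z. z ^ a * cnj z ^ b * complex_of_real (w (norm z))) \<in> borel_measurable disc_area"
      by (rule borel_measurable_times[OF borel_measurable_disc_area[OF zm] borel_measurable_complex_of_real[OF wm]])
    show "f \<in> borel_measurable disc_area" using f by (rule borel_measurable_disc_area)
    show "AE z in disc_area. z ^ a * cnj z ^ b * of_real (w (norm z)) = f z"
      using ae by eventually_elim (simp add: f_def)
  qed
  ultimately show ?thesis by simp
qed

section \<open>Coefficients of the Bergman projection\<close>

lemma radial_weight_measurable: "radial_weight w \<Longrightarrow> set_borel_measurable lebesgue {0..<1} w"
  by (auto simp: radial_weight_def set_integrable_def set_borel_measurable_def)

lemma set_integrable_lebesgue_mult_bounded:
  fixes w :: "real \<Rightarrow> real"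
  assumes w: "set_integrable lebesgue S w" and v: "set_borel_measurable lebesgue S v"
    and S: "S \<in> sets lebesgue" and bd: "\<And>r. r \<in> S \<Longrightarrow> \<bar>v r\<bar> \<le> B"
  shows "set_integrable lebesgue S (\<lambda>r. v r * w r)"
  unfolding set_integrable_def
proof (rule Bochner_Integration.integrable_bound)
  show "integrable lebesgue (\<lambda>r. B * (indicator S r *\<^sub>R w r))"
    using w unfolding set_integrable_def by (rule integrable_mult_right)
  have "(\<lambda>r. (indicator S r *\<^sub>R v r) * (indicator S r *\<^sub>R w r)) \<in> borel_measurable lebesgue"
    using v w unfolding set_integrable_def set_borel_measurable_def
    by (intro borel_measurable_times) (auto dest: borel_measurable_integrable)
  then show "(\<lambda>r. indicator S r *\<^sub>R (v r * w r)) \<in> borel_measurable lebesgue"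
    by (rule back_subst[of "\<lambda>f. f \<in> borel_measurable lebesgue"]) (auto simp: indicator_def)
  show "AE r in lebesgue. norm (indicator S r *\<^sub>R (v r * w r)) \<le> norm (B * (indicator S r *\<^sub>R w r))"
  proof (rule AE_I2)
    fix r
    show "norm (indicator S r *\<^sub>R (v r * w r)) \<le> norm (B * (indicator S r *\<^sub>R w r))"
      using bd[of r] by (auto simp: indicator_def abs_mult intro!: mult_right_mono)
  qed
qed

lemma set_integrable_power_mult:
  fixes w :: "real \<Rightarrow> real"
  assumes "set_integrable lebesgue S w" "S \<in> sets lebesgue" "S \<subseteq> {0..1}"
  shows "set_integrable lebesgue S (\<lambda>r. r ^ n * w r)"
proof (rule set_integrable_lebesgue_mult_bounded[where B = 1])
  have "(\<lambda>r::real. r ^ n) \<in> borel_measurable lebesgue"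
    by (intro measurable_completion) simp
  then show "set_borel_measurable lebesgue S (\<lambda>r. r ^ n)"
    using assms(2) unfolding set_borel_measurable_def by (intro borel_measurable_scaleR) auto
  show "\<bar>r ^ n\<bar> \<le> 1" if "r \<in> S" for r
    using that assms(3) by (auto intro!: power_le_one)
qed (use assms in auto)

lemma Linf_AE_bound:
  assumes "g \<in> Linf"
  shows "g \<in> borel_measurable disc_area" "AE z in disc_area. norm (g z) \<le> Linf_norm g"
proof -
  show gm: "g \<in> borel_measurable disc_area" using assms by (simp add: Linf_def)
  have fin: "esssup disc_area (\<lambda>z. ereal (norm (g z))) < \<infinity>" using assms by (simp add: Linf_def)
  have "AE z in disc_area. ereal (norm (g z)) \<le> esssup disc_area (\<lambda>z. ereal (norm (g z)))"
    by (rule esssup_AE)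
  then show "AE z in disc_area. norm (g z) \<le> Linf_norm g"
  proof eventually_elim
    case (elim z)
    then show ?case using fin unfolding Linf_norm_def
      by (cases "esssup disc_area (\<lambda>z. ereal (norm (g z)))") auto
  qed
qed

text \<open>A negative almost-everywhere bound on a modulus would force the disc to have measure
  zero.\<close>

lemma Linf_norm_nonneg:
  assumes "g \<in> Linf"
  shows "Linf_norm g \<ge> 0"
proof (rule ccontr)
  assume "\<not> Linf_norm g \<ge> 0"
  then have neg: "Linf_norm g < 0" by simp
  have "AE z in disc_area. False"
    using Linf_AE_bound(2)[OF assms]
  proof eventually_elim
    case (elim z)
    then show ?case using neg norm_ge_zero[of "g z"] by linarith
  qed
  then have "emeasure disc_area (space disc_area) = 0"
    unfolding ae_filter_eq_bot_iff[symmetric] trivial_limit_def .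
  then show False by (simp add: emeasure_disc_area_space space_disc_area)
qed

text \<open>The n-th Taylor coefficient of the projection of \<open>g\<close>, see
  \<open>Bergman_projection_sums\<close>.\<close>

definition proj_coeff :: "(real \<Rightarrow> real) \<Rightarrow> (complex \<Rightarrow> complex) \<Rightarrow> nat \<Rightarrow> complex" where
  "proj_coeff W g n = (LINT \<zeta>|disc_area. g \<zeta> * cnj \<zeta> ^ n * of_real (W (norm \<zeta>))) / of_real (2 * moment W (2 * n + 1))"

context
  fixes W :: "real \<Rightarrow> real"
  assumes W: "radial_weight W"
begin

lemma radial_weight_integrable: "set_integrable lebesgue {0..<1} W"
  and radial_weight_nonneg: "r \<in> {0..<1} \<Longrightarrow> W r \<ge> 0"
  and weight_tail_pos: "r \<in> {0..<1} \<Longrightarrow> weight_tail W r > 0"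
  using W by (auto simp: radial_weight_def)

lemma weight_measurable: "set_borel_measurable lebesgue {0..<1} W"
  by (rule radial_weight_measurable[OF W])

lemma moment_integrable: "set_integrable lebesgue {0..<1} (\<lambda>r. r ^ n * W r)"
  by (rule set_integrable_power_mult[OF radial_weight_integrable]) auto

text \<open>Discard the part of the integral below r. This is the source of all lower bounds for
  moments, and its positivity makes the divisions by moments meaningful.\<close>

lemma moment_ge_tail:
  assumes "r \<in> {0..<1}"
  shows "r ^ n * weight_tail W r \<le> moment W n"
proof -
  have "r ^ n * weight_tail W r = (LINT s:{r..<1}|lebesgue. r ^ n * W s)"
    by (simp add: weight_tail_def)
  also have "\<dots> \<le> (LINT s:{0..<1}|lebesgue. s ^ n * W s)"
    unfolding set_lebesgue_integral_def
  proof (rule integral_mono)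
    have "set_integrable lebesgue {r..<1} W"
      by (rule set_integrable_subset[OF radial_weight_integrable]) (use assms in auto)
    then have "set_integrable lebesgue {r..<1} (\<lambda>s. r ^ n * W s)"
      by (rule set_integrable_mult_right)
    then show "integrable lebesgue (\<lambda>x. indicator {r..<1} x *\<^sub>R (r ^ n * W x))"
      by (simp add: set_integrable_def)
    show "integrable lebesgue (\<lambda>x. indicator {0..<1} x *\<^sub>R (x ^ n * W x))"
      using moment_integrable by (simp add: set_integrable_def)
    show "indicator {r..<1} x *\<^sub>R (r ^ n * W x) \<le> indicator {0..<1} x *\<^sub>R (x ^ n * W x)" for x
      using assms radial_weight_nonneg[of x]
      by (auto simp: indicator_def intro!: mult_right_mono power_mono)
  qed
  finally show ?thesis by (simp add: moment_def)
qed

lemma moment_pos: "moment W n > 0"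
  using moment_ge_tail[of "1/2" n] weight_tail_pos[of "1/2"]
  by (smt (verit) zero_less_power mult_pos_pos atLeastLessThan_iff divide_pos_pos field_sum_of_halves)

lemma moment_antimono:
  assumes "m \<le> n"
  shows "moment W n \<le> moment W m"
  unfolding moment_def set_lebesgue_integral_def
proof (rule integral_mono)
  show "integrable lebesgue (\<lambda>x. indicator {0..<1} x *\<^sub>R (x ^ n * W x))" for n
    using moment_integrable by (simp add: set_integrable_def)
  then show "integrable lebesgue (\<lambda>x. indicator {0..<1} x *\<^sub>R (x ^ m * W x))" .
  show "indicator {0..<1} x *\<^sub>R (x ^ n * W x) \<le> indicator {0..<1} x *\<^sub>R (x ^ m * W x)" for x
    using assms radial_weight_nonneg[of x]
    by (auto simp: indicator_def intro!: mult_right_mono power_decreasing)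
qed

lemma moment_integrand_measurable: "set_borel_measurable lebesgue {0..<1} (\<lambda>r. r ^ n * W r)"
  using moment_integrable by (auto simp: set_integrable_def set_borel_measurable_def)

lemma integrable_norm_power_weight: "integrable disc_area (\<lambda>z. norm z ^ n * W (norm z))"
proof -
  have "set_integrable lebesgue {0..<1} (\<lambda>r. 2 * (r ^ Suc n * W r))"
    by (rule set_integrable_mult_right[OF moment_integrable])
  then show ?thesis
    by (subst integrable_radial_iff[OF moment_integrand_measurable]) (simp add: mult_ac)
qed

text \<open>The index is shifted by one because area measure contributes the density 2 r.\<close>

lemma integral_norm_power_weight: "(LINT z|disc_area. norm z ^ n * W (norm z)) = 2 * moment W (n + 1)"
proof -
  have "(LINT z|disc_area. norm z ^ n * W (norm z)) = (LINT r:{0..<1}|lebesgue. 2 * (r ^ (n + 1) * W r))"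
    by (subst integral_radial[OF moment_integrand_measurable]) (simp add: mult_ac)
  then show ?thesis by (simp add: moment_def)
qed

lemma radial_weight_norm_measurable: "(\<lambda>z. W (norm z)) \<in> borel_measurable disc_area"
  by (rule borel_measurable_radial[OF weight_measurable])

lemma radial_weight_norm_nonneg: "z \<in> space disc_area \<Longrightarrow> W (norm z) \<ge> 0"
  using radial_weight_nonneg by (simp add: space_disc_area)

text \<open>Since all tails are positive, the moments of order 2 n + 1 are bounded below by a
  multiple of q^(2 n) for every q < 1, so the kernel series converges throughout the disc.\<close>

lemma summable_power_over_moment:
  assumes "0 \<le> t" "t < 1"
  shows "summable (\<lambda>n. t ^ n / (2 * moment W (2 * n + 1)))"
proof -
  \<comment> \<open>Any q with t < q^2 < 1 would do; q^2 is the midpoint of t and 1.\<close>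
  define q where "q = sqrt ((1 + t) / 2)"
  have q: "0 < q" "q < 1" "q ^ 2 = (1 + t) / 2"
    using assms by (auto simp: q_def real_sqrt_lt_1_iff)
  define T where "T = weight_tail W q"
  have T: "T > 0" using weight_tail_pos q by (simp add: T_def)
  have "t / q ^ 2 < 1" using assms unfolding q(3) by (simp add: field_simps)
  moreover have "0 \<le> t / q ^ 2" using assms by simp
  ultimately have "summable (\<lambda>n. 1 / (2 * q * T) * (t / q ^ 2) ^ n)"
    by (intro summable_mult summable_geometric) simp
  moreover have "norm (t ^ n / (2 * moment W (2 * n + 1))) \<le> 1 / (2 * q * T) * (t / q ^ 2) ^ n" for n
  proof -
    have "q ^ (2 * n + 1) * T \<le> moment W (2 * n + 1)"
      unfolding T_def by (rule moment_ge_tail) (use q in auto)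
    then have "t ^ n / (2 * moment W (2 * n + 1)) \<le> t ^ n / (2 * (q ^ (2 * n + 1) * T))"
      using q T assms moment_pos[of "2*n+1"] by (intro divide_left_mono mult_left_mono mult_pos_pos) auto
    also have "\<dots> = 1 / (2 * q * T) * (t / q ^ 2) ^ n"
      unfolding power_divide power_add power_mult power_one_right times_divide_times_eq
      by (simp only: mult.assoc mult.commute mult.left_commute mult_1)
    finally show ?thesis using assms moment_pos[of "2*n+1"] by simp
  qed
  ultimately show ?thesis by (rule summable_comparison_test'[where N = 0])
qed

lemma cnj_Bergman_kernel_sums:
  assumes "norm z < 1" "norm \<zeta> < 1"
  shows "(\<lambda>n. (z * cnj \<zeta>) ^ n / complex_of_real (2 * moment W (2 * n + 1))) sums cnj (Bergman_kernel W z \<zeta>)"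
proof -
  have "norm z * norm \<zeta> < 1" 
    using mult_left_le[of "norm \<zeta>" "norm z"] assms by simp
  then have "summable (\<lambda>n. norm ((cnj z * \<zeta>) ^ n / complex_of_real (2 * moment W (2 * n + 1))))"
    using summable_power_over_moment[of "norm (cnj z * \<zeta>)"]
    by (simp add: norm_divide norm_power norm_mult abs_of_pos[OF moment_pos])
  then have "(\<lambda>n. (cnj z * \<zeta>) ^ n / complex_of_real (2 * moment W (2 * n + 1))) sums Bergman_kernel W z \<zeta>"
    unfolding Bergman_kernel_def by (rule summable_sums[OF summable_norm_cancel])
  then have "(\<lambda>n. cnj ((cnj z * \<zeta>) ^ n / complex_of_real (2 * moment W (2 * n + 1)))) sums cnj (Bergman_kernel W z \<zeta>)"
    by (simp only: sums_cnj)
  then show ?thesis by simp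
qed

lemma integrable_Linf_times:
  fixes u :: "complex \<Rightarrow> complex"
  assumes g: "g \<in> Linf" and u: "continuous_on UNIV u" "\<And>z. norm z < 1 \<Longrightarrow> norm (u z) \<le> B"
  shows "integrable disc_area (\<lambda>z. g z * u z * of_real (W (norm z)))"
    and "(LINT z|disc_area. norm (g z * u z * of_real (W (norm z)))) \<le> Linf_norm g * (LINT z|disc_area. norm (u z) * W (norm z))"
proof -
  have um: "u \<in> borel_measurable disc_area"
    by (intro borel_measurable_disc_area borel_measurable_continuous_onI u)
  have B: "B \<ge> 0" using order_trans[OF norm_ge_zero u(2)[of 0]] by simp
  have uW: "integrable disc_area (\<lambda>z. norm (u z) * W (norm z))"
  proof (rule Bochner_Integration.integrable_bound)
    show "integrable disc_area (\<lambda>z. B * (norm z ^ 0 * W (norm z)))"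
      by (intro integrable_mult_right integrable_norm_power_weight)
    show "(\<lambda>z. norm (u z) * W (norm z)) \<in> borel_measurable disc_area"
      by (rule borel_measurable_times[OF measurable_compose[OF um borel_measurable_norm] radial_weight_norm_measurable])
    show "AE z in disc_area. norm (norm (u z) * W (norm z)) \<le> norm (B * (norm z ^ 0 * W (norm z)))"
      using u(2) radial_weight_norm_nonneg B
      by (intro AE_I2) (auto simp: space_disc_area abs_mult intro!: mult_right_mono)
  qed
  have uW': "integrable disc_area (\<lambda>z. Linf_norm g * (norm (u z) * W (norm z)))"
    by (intro integrable_mult_right uW)
  have ae: "AE z in disc_area. norm (g z * u z * of_real (W (norm z))) \<le> Linf_norm g * (norm (u z) * W (norm z))"
    using Linf_AE_bound(2)[OF g] AE_space
  proof eventually_elim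
    case (elim z)
    then show ?case using radial_weight_norm_nonneg[of z]
      by (auto simp: norm_mult mult.assoc intro!: mult_right_mono)
  qed
  show int: "integrable disc_area (\<lambda>z. g z * u z * of_real (W (norm z)))"
    using uW'
  proof (rule Bochner_Integration.integrable_bound)
    show "(\<lambda>z. g z * u z * complex_of_real (W (norm z))) \<in> borel_measurable disc_area"
      by (intro borel_measurable_times Linf_AE_bound(1)[OF g] um borel_measurable_complex_of_real radial_weight_norm_measurable)
    show "AE z in disc_area. norm (g z * u z * complex_of_real (W (norm z))) \<le> norm (Linf_norm g * (norm (u z) * W (norm z)))"
      using ae by eventually_elim auto
  qed
  have "(LINT z|disc_area. norm (g z * u z * of_real (W (norm z)))) \<le> (LINT z|disc_area. Linf_norm g * (norm (u z) * W (norm z)))"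
    using int uW' ae by (intro integral_mono_AE integrable_norm)
  then show "(LINT z|disc_area. norm (g z * u z * of_real (W (norm z)))) \<le> Linf_norm g * (LINT z|disc_area. norm (u z) * W (norm z))"
    by simp
qed

text \<open>For fixed z the terms of the kernel series are bounded on the whole disc by the summable
  numbers \<open>norm (q n)\<close>, so integration against the bounded function \<open>g\<close>
  may be done term by term.\<close>

lemma Bergman_projection_sums:
  assumes g: "g \<in> Linf" and z: "norm z < 1"
  shows "(\<lambda>n. proj_coeff W g n * z ^ n) sums Bergman_projection W g z"
proof -
  define q where "q n = (z ^ n) / of_real (2 * moment W (2 * n + 1))" for n
  define f where "f n \<zeta> = g \<zeta> * (q n * cnj \<zeta> ^ n) * of_real (W (norm \<zeta>))" for n \<zeta>
  have q: "summable (\<lambda>n. norm (q n))"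
    using summable_power_over_moment[of "norm z"] z
    by (simp add: q_def norm_divide norm_power abs_of_pos[OF moment_pos])
  have cont: "continuous_on UNIV (\<lambda>\<zeta>. q n * cnj \<zeta> ^ n)" for n
    by (intro continuous_intros)
  have bd: "norm (q n * cnj \<zeta> ^ n) \<le> norm (q n)" if "norm \<zeta> < 1" for n \<zeta>
    using that by (simp add: norm_mult norm_power power_le_one mult_left_le)
  have int: "integrable disc_area (f n)" for n
    unfolding f_def by (rule integrable_Linf_times(1)[OF g cont bd])
  have eq: "f n \<zeta> = g \<zeta> * of_real (W (norm \<zeta>)) * ((z * cnj \<zeta>) ^ n / complex_of_real (2 * moment W (2 * n + 1)))" for n \<zeta>
    by (simp add: f_def q_def power_mult_distrib)
  have sums: "(\<lambda>n. f n \<zeta>) sums (g \<zeta> * cnj (Bergman_kernel W z \<zeta>) * of_real (W (norm \<zeta>)))" if "\<zeta> \<in> space disc_area" for \<zeta>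
    using sums_mult[OF cnj_Bergman_kernel_sums[OF z], of \<zeta> "g \<zeta> * of_real (W (norm \<zeta>))"] that
    by (simp add: eq space_disc_area mult_ac)
  have 1: "AE \<zeta> in disc_area. summable (\<lambda>n. norm (f n \<zeta>))"
  proof (rule AE_I2)
    fix \<zeta> assume "\<zeta> \<in> space disc_area"
    then have \<zeta>: "norm \<zeta> < 1" by (simp add: space_disc_area)
    have "summable (\<lambda>n. norm (g \<zeta>) * \<bar>W (norm \<zeta>)\<bar> * norm (q n))"
      by (rule summable_mult[OF q])
    then show "summable (\<lambda>n. norm (f n \<zeta>))"
    proof (rule summable_comparison_test'[where N = 0])
      fix n
      have "norm (g \<zeta>) * norm (q n * cnj \<zeta> ^ n) * \<bar>W (norm \<zeta>)\<bar> \<le> norm (g \<zeta>) * norm (q n) * \<bar>W (norm \<zeta>)\<bar>"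
        by (intro mult_right_mono mult_left_mono bd \<zeta>) auto
      then show "norm (norm (f n \<zeta>)) \<le> norm (g \<zeta>) * \<bar>W (norm \<zeta>)\<bar> * norm (q n)"
        by (simp add: f_def norm_mult mult_ac)
    qed
  qed
  have 2: "summable (\<lambda>n. LINT \<zeta>|disc_area. norm (f n \<zeta>))"
  proof (rule summable_comparison_test'[where N = 0])
    show "summable (\<lambda>n. Linf_norm g * (LINT z|disc_area. norm z ^ 0 * W (norm z)) * norm (q n))"
      by (rule summable_mult[OF q])
    fix n
    have "(LINT \<zeta>|disc_area. norm (f n \<zeta>)) \<le> Linf_norm g * (LINT \<zeta>|disc_area. norm (q n * cnj \<zeta> ^ n) * W (norm \<zeta>))"
      unfolding f_def by (rule integrable_Linf_times(2)[OF g cont bd])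
    also have "\<dots> = Linf_norm g * (norm (q n) * (2 * moment W (n + 1)))"
      using integral_norm_power_weight[of n] by (simp add: norm_mult norm_power mult.assoc)
    \<comment> \<open>Replacing the moment by the one of order 1 removes all dependence on n except
      through \<open>q n\<close>.\<close>
    also have "\<dots> \<le> Linf_norm g * (norm (q n) * (2 * moment W (0 + 1)))"
    proof -
      have "0 \<le> Linf_norm g"
        by (rule Linf_norm_nonneg[OF g])
      then show ?thesis
        by (intro mult_left_mono moment_antimono) auto
    qed
    also have "\<dots> = Linf_norm g * (LINT z|disc_area. norm z ^ 0 * W (norm z)) * norm (q n)"
      using integral_norm_power_weight[of 0] by simp
    finally show "norm (LINT \<zeta>|disc_area. norm (f n \<zeta>)) \<le> Linf_norm g * (LINT z|disc_area. norm z ^ 0 * W (norm z)) * norm (q n)"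
      by simp
  qed
  have "(\<lambda>n. LINT \<zeta>|disc_area. f n \<zeta>) sums (LINT \<zeta>|disc_area. (\<Sum>n. f n \<zeta>))"
    by (rule sums_integral[OF int 1 2])
  moreover have "(LINT \<zeta>|disc_area. (\<Sum>n. f n \<zeta>)) = Bergman_projection W g z"
    unfolding Bergman_projection_def
    by (rule Bochner_Integration.integral_cong) (auto simp: sums_unique[OF sums, symmetric])
  moreover have "(LINT \<zeta>|disc_area. f n \<zeta>) = proj_coeff W g n * z ^ n" for n
  proof -
    have "(LINT \<zeta>|disc_area. f n \<zeta>) = (LINT \<zeta>|disc_area. q n * (g \<zeta> * cnj \<zeta> ^ n * of_real (W (norm \<zeta>))))"
      by (rule Bochner_Integration.integral_cong) (simp_all only: f_def mult_ac)
    then show ?thesis by (simp add: proj_coeff_def q_def)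
  qed
  ultimately show ?thesis by simp
qed

end

section \<open>Test functions\<close>

lemma powser_sums_unique_disc:
  fixes a b :: "nat \<Rightarrow> complex"
  assumes "\<And>z. norm z < 1 \<Longrightarrow> (\<lambda>n. a n * z ^ n) sums f z"
    and "\<And>z. norm z < 1 \<Longrightarrow> (\<lambda>n. b n * z ^ n) sums f z"
  shows "a = b"
proof -
  have ev: "eventually (\<lambda>z::complex. norm z < 1) (nhds 0)"
    using eventually_nhds_in_open[of "ball (0::complex) 1" 0] by simp
  have "f has_fps_expansion Abs_fps a" "f has_fps_expansion Abs_fps b"
    by (rule has_fps_expansionI, rule eventually_mono[OF ev], simp add: assms)+
  then have "Abs_fps a = Abs_fps b"
    by (rule fps_expansion_unique_complex)
  then show ?thesis by (simp add: Abs_fps_inject)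
qed

section \<open>Boundedness of the projection tested on unimodular functions\<close>

lemma sgn_power_in_Linf: "(\<lambda>z. sgn z ^ N) \<in> Linf" "Linf_norm (\<lambda>z. sgn z ^ N) \<le> 1"
proof -
  have m: "(\<lambda>z::complex. sgn z ^ N) \<in> borel_measurable disc_area"
    unfolding sgn_div_norm
    by (intro borel_measurable_disc_area) measurable
  have le: "norm (sgn z ^ N) \<le> 1" for z :: complex
    by (auto simp: norm_power norm_sgn power_0_left)
  have e: "esssup disc_area (\<lambda>z. ereal (norm (sgn z ^ N))) \<le> 1"
    using m le by (intro esssup_I AE_I2) auto
  show "(\<lambda>z. sgn z ^ N) \<in> Linf"
    unfolding Linf_def using m e by (auto simp: order_le_less_trans)
  then have "0 \<le> Linf_norm (\<lambda>z. sgn z ^ N)" by (rule Linf_norm_nonneg)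
  show "Linf_norm (\<lambda>z. sgn z ^ N) \<le> 1"
    using e unfolding Linf_norm_def
    by (cases "esssup disc_area (\<lambda>z. ereal (norm (sgn z ^ N)))") auto
qed

lemma sgn_power_cnj: "sgn z ^ N * cnj z ^ N = of_real (norm z ^ N)"
proof (cases "z = 0")
  case False
  have "sgn z * cnj z = of_real (norm z)"
    using False by (simp add: sgn_div_norm scaleR_conv_of_real complex_norm_square[symmetric] power2_eq_square field_simps)
  then show ?thesis by (metis of_real_power power_mult_distrib)
qed (auto simp: power_0_left)

text \<open>Bernoulli's inequality for the full exponent 2 k would only give 0; for the exponent k
  it gives 1/2, and squaring gives 1/4.\<close>

lemma power_one_minus_inverse_ge:
  assumes "k \<ge> (1::nat)"
  shows "(1 - 1 / real (2 * k)) ^ (2 * k) \<ge> 1 / 4"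
proof -
  have "(1 - 1 / real (2 * k)) ^ k \<ge> 1 / 2"
    using Bernoulli_inequality[of "- (1 / real (2 * k))" k] assms by (simp add: field_simps)
  then have "((1 - 1 / real (2 * k)) ^ k)\<^sup>2 \<ge> (1 / 2)\<^sup>2"
    by (intro power_mono) auto
  then show ?thesis
    by (simp only: power_mult[symmetric] mult.commute[of k 2]) (simp add: power2_eq_square)
qed

lemma Bloch_norm_ge:
  assumes "f \<in> Bloch" "norm z < 1"
  shows "norm (deriv f z) * (1 - (norm z)\<^sup>2) \<le> Bloch_norm f"
proof -
  have "norm (deriv f z) * (1 - (norm z)\<^sup>2) \<le> (SUP z\<in>unit_disc. norm (deriv f z) * (1 - (norm z)\<^sup>2))"
    using assms by (intro cSUP_upper) (auto simp: Bloch_def)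
  then show ?thesis
    using norm_ge_zero[of "f 0"] unfolding Bloch_norm_def by linarith
qed

text \<open>By angular orthogonality only the N-th coefficient survives. Its numerator contains only
  one factor of modulus |z|^N, hence the moment of order N + 1, against 2 N + 1 in the
  denominator.\<close>

lemma Bergman_projection_sgn_power:
  assumes W: "radial_weight W" and z: "norm z < 1"
  shows "Bergman_projection W (\<lambda>z. sgn z ^ N) z = of_real (moment W (N + 1) / moment W (2 * N + 1)) * z ^ N"
proof -
  have wN: "set_borel_measurable lebesgue {0..<1} (\<lambda>r. r ^ n * W r)" for n
    by (rule moment_integrand_measurable[OF W])
  have coeff: "proj_coeff W (\<lambda>z. sgn z ^ N) n = (if n = N then of_real (moment W (N + 1) / moment W (2 * N + 1)) else 0)" for n
  proof (cases "n = N")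
    case True
    have "(LINT \<zeta>|disc_area. sgn \<zeta> ^ N * cnj \<zeta> ^ N * of_real (W (norm \<zeta>)))
        = (LINT \<zeta>|disc_area. of_real (norm \<zeta> ^ N * W (norm \<zeta>)))"
      by (intro Bochner_Integration.integral_cong) (simp_all add: sgn_power_cnj)
    also have "\<dots> = of_real (2 * moment W (N + 1))"
      by (simp only: integral_complex_of_real integral_norm_power_weight[OF W])
    finally show ?thesis
      using True moment_pos[OF W, of "2 * N + 1"] by (simp add: proj_coeff_def)
  next
    case False
    \<comment> \<open>Moving the modulus of z^N into the radial factor turns the integrand into a
      monomial times a radial function. At the origin \<open>sgn 0 = 0\<close> agrees with the value
      0 of the division.\<close>
    define w where "w r = (1 / r ^ N) * W r" for r
    have wm: "set_borel_measurable lebesgue {0..<1} w"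
    proof -
      have 1: "(\<lambda>r::real. 1 / r ^ N) \<in> borel_measurable lebesgue"
        by (intro measurable_completion) simp
      have 2: "(\<lambda>r. indicator {0..<1} r *\<^sub>R W r) \<in> borel_measurable lebesgue"
        using weight_measurable[OF W] by (simp add: set_borel_measurable_def)
      have "(\<lambda>r. (1 / r ^ N) * (indicator {0..<1} r *\<^sub>R W r)) \<in> borel_measurable lebesgue"
        by (rule borel_measurable_times[OF 1 2])
      then show ?thesis
        by (simp add: set_borel_measurable_def w_def mult_ac)
    qed
    have "(LINT \<zeta>|disc_area. sgn \<zeta> ^ N * cnj \<zeta> ^ n * of_real (W (norm \<zeta>)))
        = (LINT \<zeta>|disc_area. \<zeta> ^ N * cnj \<zeta> ^ n * of_real (w (norm \<zeta>)))"
      by (intro Bochner_Integration.integral_cong)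
         (simp_all add: w_def sgn_div_norm scaleR_conv_of_real power_mult_distrib power_inverse divide_inverse mult_ac)
    also have "\<dots> = 0"
      using False by (intro integral_monomial_radial_eq_0[OF wm]) auto
    finally show ?thesis using False by (simp add: proj_coeff_def)
  qed
  have "(\<lambda>n. proj_coeff W (\<lambda>z. sgn z ^ N) n * z ^ n) sums Bergman_projection W (\<lambda>z. sgn z ^ N) z"
    by (rule Bergman_projection_sums[OF W sgn_power_in_Linf(1) z])
  moreover have "(\<lambda>n. proj_coeff W (\<lambda>z. sgn z ^ N) n * z ^ n)
      sums (of_real (moment W (N + 1) / moment W (2 * N + 1)) * z ^ N)"
    unfolding coeff using sums_single[of N "\<lambda>n. of_real (moment W (N + 1) / moment W (2 * N + 1)) * z ^ n"]
    by (rule sums_cong[THEN iffD1, rotated]) auto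
  ultimately show ?thesis by (rule sums_unique2)
qed

lemma projection_bounded_imp_moment_doubling:
  assumes W: "radial_weight W" and bd: "projection_bounded W"
  obtains C where "C > 0" "\<And>k. k \<ge> 1 \<Longrightarrow> moment W (2 * k + 1) \<le> C * moment W (4 * k + 1)"
proof -
  obtain C where C: "C > 0" and P: "\<And>g. g \<in> Linf \<Longrightarrow> Bergman_projection W g \<in> Bloch"
    "\<And>g. g \<in> Linf \<Longrightarrow> Bloch_norm (Bergman_projection W g) \<le> C * Linf_norm g"
    using bd unfolding projection_bounded_def by blast
  have "moment W (2 * k + 1) \<le> (4 * C) * moment W (4 * k + 1)" if k: "k \<ge> 1" for k
  proof -
    define N where "N = 2 * k"
    define g where "g = (\<lambda>z::complex. sgn z ^ N)"
    define c where "c = moment W (N + 1) / moment W (2 * N + 1)"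
    \<comment> \<open>At this radius N (1 - r) = 1, so the Bloch quantity of c z^N is at least c
      r^(N-1), hence at least c / 4. The exponent N is even to fit
      \<open>power_one_minus_inverse_ge\<close>.\<close>
    define r where "r = 1 - 1 / real N"
    have N: "N \<ge> 2" using k by (simp add: N_def)
    have r: "0 \<le> r" "r < 1" using N by (auto simp: r_def)
    have c: "c > 0" using moment_pos[OF W] by (simp add: c_def)
    have rN: "1 / 4 \<le> r ^ N"
      using power_one_minus_inverse_ge[OF k] by (simp add: r_def N_def)
    have eq: "Bergman_projection W g z = of_real c * z ^ N" if "norm z < 1" for z
      unfolding g_def c_def by (rule Bergman_projection_sgn_power[OF W that])
    \<comment> \<open>The projection is known to be a power of z only inside the disc; agreement
      near the point suffices for the derivative.\<close>
    have "eventually (\<lambda>z. z \<in> unit_disc) (nhds (of_real r :: complex))"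
      using r by (intro eventually_nhds_in_open) auto
    then have "eventually (\<lambda>z. Bergman_projection W g z = of_real c * z ^ N) (nhds (of_real r))"
      by eventually_elim (simp add: eq)
    then have "deriv (Bergman_projection W g) (of_real r) = deriv (\<lambda>z. of_real c * z ^ N) (of_real r)"
      by (rule deriv_cong_ev) simp
    also have "\<dots> = of_real c * (of_nat N * of_real r ^ (N - 1))"
      by (rule DERIV_imp_deriv) (auto intro!: derivative_eq_intros)
    finally have d: "norm (deriv (Bergman_projection W g) (of_real r)) = c * (real N * r ^ (N - 1))"
      using c r by (simp add: norm_mult norm_power)
    have "c * (1 / 4) \<le> c * (r ^ (N - 1))"
    proof -
      have "r ^ N \<le> r ^ (N - 1)" using r by (intro power_decreasing) auto
      then show ?thesis using rN c by (intro mult_left_mono) auto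
    qed
    also have "\<dots> = c * (real N * r ^ (N - 1)) * (1 - r)"
      using N by (simp add: r_def)
    also have "\<dots> \<le> c * (real N * r ^ (N - 1)) * (1 - r\<^sup>2)"
    proof (rule mult_left_mono)
      show "1 - r \<le> 1 - r\<^sup>2" using r by (simp add: power2_eq_square mult_left_le)
    qed (use c r in auto)
    also have "\<dots> \<le> Bloch_norm (Bergman_projection W g)"
      using Bloch_norm_ge[OF P(1), of g "of_real r"] d r sgn_power_in_Linf(1)[of N] by (simp add: g_def)
    also have "\<dots> \<le> C * Linf_norm g"
      using P(2) sgn_power_in_Linf(1) by (simp add: g_def)
    also have "\<dots> \<le> C * 1"
      using C sgn_power_in_Linf(2) by (intro mult_left_mono) (auto simp: g_def)
    finally have "c \<le> 4 * C" by simp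
    then show ?thesis
      using moment_pos[OF W, of "2 * N + 1"] by (simp add: c_def N_def field_simps)
  qed
  then show ?thesis using C by (intro that[of "4 * C"]) auto
qed

section \<open>The Bloch embedding tested on lacunary polynomials\<close>

text \<open>The term of index K + 1 is spread over the block of exponents from 2^K to 2^(K+1) - 1,
  on which r^j is at least its right-end value. A block has half as many members as the coefficient
  2^(K+1), whence the factor 2.\<close>

lemma sum_lacunary_le:
  fixes r :: real
  assumes "0 \<le> r" "r \<le> 1"
  shows "(\<Sum>k\<in>{1..K}. 2 ^ k * r ^ (2 ^ k - 1)) \<le> 2 * (\<Sum>j<2 ^ K. r ^ j)"
proof (induction K)
  case 0
  then show ?case by simp
next
  case (Suc K)
  have "2 ^ Suc K * r ^ (2 ^ Suc K - 1) = 2 * (\<Sum>j\<in>{2 ^ K..<2 ^ Suc K :: nat}. r ^ (2 ^ Suc K - 1))"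
    by simp
  also have "\<dots> \<le> 2 * (\<Sum>j\<in>{2 ^ K..<2 ^ Suc K :: nat}. r ^ j)"
    using assms by (intro mult_left_mono sum_mono power_decreasing) auto
  finally have "2 ^ Suc K * r ^ (2 ^ Suc K - 1) \<le> 2 * (\<Sum>j\<in>{2 ^ K..<2 ^ Suc K :: nat}. r ^ j)" .
  moreover have "(\<Sum>j<2 ^ Suc K. r ^ j) = (\<Sum>j<2 ^ K. r ^ j) + (\<Sum>j\<in>{2 ^ K..<2 ^ Suc K :: nat}. r ^ j)"
    by (subst sum.union_disjoint[symmetric]) (auto intro!: sum.cong)
  ultimately show ?case using Suc.IH by simp
qed

text \<open>The geometric sum in \<open>sum_lacunary_le\<close> is at most 1 / (1 - r), so the
  derivative is at most 2 / (1 - r), and 1 - r^2 = (1 - r)(1 + r) costs another 2. The bound depends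
  neither on the number of terms nor on their degrees.\<close>

lemma lacunary_Bloch:
  assumes B: "B \<subseteq> (\<lambda>k::nat. 2 ^ k) ` {1..K}"
  defines "f \<equiv> \<lambda>z::complex. \<Sum>i\<in>B. z ^ i"
  shows "f \<in> Bloch" "Bloch_norm f \<le> 4"
proof -
  have fin: "finite B" using B by (rule finite_subset) simp
  have d: "deriv f z = (\<Sum>i\<in>B. of_nat i * z ^ (i - 1))" for z
    unfolding f_def by (rule DERIV_imp_deriv) (auto intro!: derivative_eq_intros)
  have bd: "norm (deriv f z) * (1 - (norm z)\<^sup>2) \<le> 4" if z: "norm z < 1" for z
  proof -
    define r where "r = norm z"
    have r: "0 \<le> r" "r < 1" using z by (auto simp: r_def)
    have "norm (deriv f z) \<le> (\<Sum>i\<in>B. real i * r ^ (i - 1))"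
      unfolding d by (rule sum_norm_le) (simp add: norm_mult norm_power r_def)
    also have "\<dots> \<le> (\<Sum>i\<in>(\<lambda>k::nat. 2 ^ k) ` {1..K}. real i * r ^ (i - 1))"
      using B r by (intro sum_mono2) auto
    also have "\<dots> = (\<Sum>k\<in>{1..K}. 2 ^ k * r ^ (2 ^ k - 1))"
      by (subst sum.reindex) (auto simp: inj_on_def)
    also have "\<dots> \<le> 2 * (\<Sum>j<2 ^ K. r ^ j)"
      using r by (intro sum_lacunary_le) auto
    finally have 1: "norm (deriv f z) \<le> 2 * (\<Sum>j<2 ^ K. r ^ j)" .
    have "(1 - r) * (\<Sum>j<2 ^ K. r ^ j) = 1 - r ^ (2 ^ K)"
      by (rule one_diff_power_eq[symmetric])
    then have 2: "(1 - r) * (\<Sum>j<2 ^ K. r ^ j) \<le> 1" using r by simp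
    have "norm (deriv f z) * (1 - r\<^sup>2) \<le> 2 * (\<Sum>j<2 ^ K. r ^ j) * (1 - r\<^sup>2)"
      using 1 r by (intro mult_right_mono) (auto simp: power_le_one)
    also have "\<dots> = 2 * ((1 - r) * (\<Sum>j<2 ^ K. r ^ j)) * (1 + r)"
      by (simp add: power2_eq_square algebra_simps)
    also have "\<dots> \<le> 2 * 1 * 2"
      using 2 r by (intro mult_mono) (auto intro!: mult_nonneg_nonneg sum_nonneg)
    finally show ?thesis by (simp add: r_def)
  qed
  show "f \<in> Bloch"
    unfolding Bloch_def using bd by (auto simp: f_def intro!: bdd_aboveI[of _ 4] holomorphic_intros)
  have "f 0 = 0"
    unfolding f_def using B by (intro sum.neutral) (auto simp: power_0_left)
  moreover have "(SUP z\<in>unit_disc. norm (deriv f z) * (1 - (norm z)\<^sup>2)) \<le> 4"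
    using bd by (intro cSUP_least) auto
  ultimately show "Bloch_norm f \<le> 4" by (simp add: Bloch_norm_def)
qed

context
  fixes W :: "real \<Rightarrow> real"
  assumes W: "radial_weight W"
begin

text \<open>Uniqueness of Taylor coefficients: although \<open>g\<close> is unknown, its pairing
  with each occurring power of z is determined.\<close>

lemma Bergman_projection_eq_poly_coeff:
  assumes g: "g \<in> Linf" and B: "finite B"
    and eq: "\<And>z. norm z < 1 \<Longrightarrow> Bergman_projection W g z = (\<Sum>i\<in>B. z ^ i)" and i: "i \<in> B"
  shows "(LINT \<zeta>|disc_area. g \<zeta> * cnj \<zeta> ^ i * of_real (W (norm \<zeta>))) = of_real (2 * moment W (2 * i + 1))"
proof -
  have "proj_coeff W g = (\<lambda>n. if n \<in> B then 1 else 0)"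
  proof (rule powser_sums_unique_disc)
    fix z :: complex assume z: "norm z < 1"
    show "(\<lambda>n. proj_coeff W g n * z ^ n) sums Bergman_projection W g z"
      by (rule Bergman_projection_sums[OF W g z])
    have "(\<lambda>n. if n \<in> B then z ^ n else 0) sums (\<Sum>i\<in>B. z ^ i)"
      by (rule sums_If_finite_set[OF B])
    then show "(\<lambda>n. (if n \<in> B then 1 else 0) * z ^ n) sums Bergman_projection W g z"
      unfolding eq[OF z] by (rule back_subst[of "\<lambda>f. f sums _"]) auto
  qed
  then have "proj_coeff W g i = 1" using i by simp
  then show ?thesis
    using moment_pos[OF W, of "2 * i + 1"] by (simp add: proj_coeff_def field_simps split: if_splits)
qed

text \<open>Monomials are orthogonal for every radial weight, so only the diagonal remains. The
  extra factor |z|^M prepares the estimate \<open>integral_norm_sum_le\<close>.\<close>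

lemma integral_norm_sum_sq:
  fixes B :: "nat set"
  assumes B: "finite B"
  shows "integrable disc_area (\<lambda>z. (norm (\<Sum>i\<in>B. z ^ i))\<^sup>2 * (norm z ^ M * W (norm z)))"
    and "(LINT z|disc_area. (norm (\<Sum>i\<in>B. z ^ i))\<^sup>2 * (norm z ^ M * W (norm z))) = (\<Sum>i\<in>B. 2 * moment W (2 * i + M + 1))"
proof -
  let ?w = "\<lambda>r. r ^ M * W r"
  have mon: "integrable disc_area (\<lambda>z. z ^ i * cnj z ^ j * of_real (?w (norm z)))" for i j
  proof (rule Bochner_Integration.integrable_bound)
    show "integrable disc_area (\<lambda>z. norm z ^ M * W (norm z))"
      by (rule integrable_norm_power_weight[OF W])
    show "(\<lambda>z. z ^ i * cnj z ^ j * complex_of_real (?w (norm z))) \<in> borel_measurable disc_area"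
      by (intro borel_measurable_times borel_measurable_complex_of_real
          borel_measurable_integrable[OF integrable_norm_power_weight[OF W]]
          borel_measurable_disc_area borel_measurable_continuous_onI continuous_intros)
    show "AE z in disc_area. norm (z ^ i * cnj z ^ j * of_real (?w (norm z))) \<le> norm (norm z ^ M * W (norm z))"
    proof (rule AE_I2)
      fix z assume "z \<in> space disc_area"
      then have "norm (z ^ i * cnj z ^ j) \<le> 1"
        by (simp add: space_disc_area norm_mult norm_power power_le_one mult_le_one)
      then show "norm (z ^ i * cnj z ^ j * of_real (?w (norm z))) \<le> norm (norm z ^ M * W (norm z))"
        unfolding norm_mult[of "z ^ i * cnj z ^ j"] norm_of_real real_norm_def
        by (rule mult_left_le_one_le[rotated 2]) auto
    qed
  qed
  have val: "(LINT z|disc_area. z ^ i * cnj z ^ j * of_real (?w (norm z)))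
      = (if i = j then of_real (2 * moment W (2 * i + M + 1)) else 0)" for i j
  proof (cases "i = j")
    case True
    have "(LINT z|disc_area. z ^ i * cnj z ^ i * of_real (?w (norm z)))
        = (LINT z|disc_area. of_real (norm z ^ (2 * i + M) * W (norm z)))"
    proof (rule Bochner_Integration.integral_cong)
      fix z :: complex
      have "z ^ i * cnj z ^ i = of_real (norm z ^ (2 * i))"
        by (simp add: power_mult_distrib[symmetric] complex_norm_square[symmetric] power_mult)
      then show "z ^ i * cnj z ^ i * of_real (?w (norm z)) = of_real (norm z ^ (2 * i + M) * W (norm z))"
        by (simp add: power_add)
    qed simp
    also have "\<dots> = of_real (2 * moment W (2 * i + M + 1))"
      by (simp only: integral_complex_of_real integral_norm_power_weight[OF W])
    finally show ?thesis using True by simp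
  next
    case False
    then show ?thesis
      using integral_monomial_radial_eq_0[OF moment_integrand_measurable[OF W], of i j M] by simp
  qed
  have eq: "complex_of_real ((norm (\<Sum>i\<in>B. z ^ i))\<^sup>2 * (norm z ^ M * W (norm z)))
      = (\<Sum>i\<in>B. \<Sum>j\<in>B. z ^ i * cnj z ^ j * of_real (?w (norm z)))" for z
    by (subst of_real_mult) (simp only: complex_norm_square cnj_sum complex_cnj_power sum_product,
        simp only: sum_distrib_right)
  have intc: "integrable disc_area (\<lambda>z. complex_of_real ((norm (\<Sum>i\<in>B. z ^ i))\<^sup>2 * (norm z ^ M * W (norm z))))"
    unfolding eq by (intro Bochner_Integration.integrable_sum mon)
  from integrable_Re[OF this] show "integrable disc_area (\<lambda>z. (norm (\<Sum>i\<in>B. z ^ i))\<^sup>2 * (norm z ^ M * W (norm z)))"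
    by (simp only: Re_complex_of_real)
  have "complex_of_real (LINT z|disc_area. (norm (\<Sum>i\<in>B. z ^ i))\<^sup>2 * (norm z ^ M * W (norm z)))
      = (LINT z|disc_area. (\<Sum>i\<in>B. \<Sum>j\<in>B. z ^ i * cnj z ^ j * of_real (?w (norm z))))"
    unfolding eq[symmetric] by (rule integral_complex_of_real[symmetric])
  also have "\<dots> = (\<Sum>i\<in>B. \<Sum>j\<in>B. (if i = j then of_real (2 * moment W (2 * i + M + 1)) else 0))"
    by (simp only: Bochner_Integration.integral_sum Bochner_Integration.integrable_sum mon val)
  also have "\<dots> = of_real (\<Sum>i\<in>B. 2 * moment W (2 * i + M + 1))"
    using B by (simp add: sum.delta')
  finally show "(LINT z|disc_area. (norm (\<Sum>i\<in>B. z ^ i))\<^sup>2 * (norm z ^ M * W (norm z))) = (\<Sum>i\<in>B. 2 * moment W (2 * i + M + 1))"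
    by (simp only: of_real_eq_iff)
qed

text \<open>Cauchy-Schwarz in the form 2 h <= h^2 / s + s. The common factor z^M is taken out first
  and only once, outside the square, so that both terms are governed by the same moment of order M +
  1.\<close>

lemma integral_norm_sum_le:
  assumes B: "finite B" "B \<noteq> {}" and M: "\<And>i. i \<in> B \<Longrightarrow> M \<le> i"
  shows "(LINT z|disc_area. norm (\<Sum>i\<in>B. z ^ i) * W (norm z)) \<le> 2 * sqrt (card B) * moment W (M + 1)"
proof -
  \<comment> \<open>This choice balances the two terms: the square contributes at most card B = s *
    s moments, divided by s.\<close>
  define s where "s = sqrt (card B)"
  have s: "s > 0" using B by (simp add: s_def card_gt_0_iff)
  have s2: "s * s = card B" by (simp add: s_def)
  define D where "D = (\<lambda>i. i - M) ` B"
  have D: "finite D" using B by (simp add: D_def)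
  have inj: "inj_on (\<lambda>i. i - M) B" using M by (auto simp: inj_on_def) (metis le_add_diff_inverse)
  have cD: "card D = card B" unfolding D_def by (rule card_image[OF inj])
  let ?h = "\<lambda>z::complex. \<Sum>i\<in>D. z ^ i"
  have fac: "(\<Sum>i\<in>B. z ^ i) = z ^ M * ?h z" for z :: complex
  proof -
    have "z ^ M * ?h z = (\<Sum>i\<in>B. z ^ M * z ^ (i - M))"
      unfolding D_def by (simp add: sum.reindex[OF inj] sum_distrib_left)
    also have "\<dots> = (\<Sum>i\<in>B. z ^ i)"
      using M by (intro sum.cong) (auto simp flip: power_add)
    finally show ?thesis ..
  qed
  let ?v = "\<lambda>z. ((norm (?h z))\<^sup>2 * (norm z ^ M * W (norm z))) / s + s * (norm z ^ M * W (norm z))"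
  have int: "integrable disc_area ?v"
    by (intro Bochner_Integration.integrable_add integrable_divide integrable_mult_right
        integral_norm_sum_sq(1)[OF D] integrable_norm_power_weight[OF W])
  have le: "norm (\<Sum>i\<in>B. z ^ i) * W (norm z) \<le> ?v z / 2" if "z \<in> space disc_area" for z
  proof -
    define h where "h = norm (?h z)"
    have "0 \<le> (h - s)\<^sup>2" by simp
    then have "2 * h * s \<le> h\<^sup>2 + s * s" by (simp add: power2_eq_square algebra_simps)
    then have "h \<le> (h\<^sup>2 / s + s) / 2" using s by (simp add: field_simps)
    moreover have "norm z ^ M * W (norm z) \<ge> 0"
      using radial_weight_norm_nonneg[OF W that] by simp
    ultimately have "h * (norm z ^ M * W (norm z)) \<le> ((h\<^sup>2 / s + s) / 2) * (norm z ^ M * W (norm z))"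
      by (rule mult_right_mono)
    also have "\<dots> = ?v z / 2"
      unfolding h_def using s by (simp add: field_simps)
    finally show ?thesis
      unfolding fac norm_mult norm_power h_def by (simp only: mult_ac)
  qed
  have "(LINT z|disc_area. norm (\<Sum>i\<in>B. z ^ i) * W (norm z)) \<le> (LINT z|disc_area. ?v z / 2)"
  proof (rule integral_mono)
    show i2: "integrable disc_area (\<lambda>z. ?v z / 2)" by (intro integrable_divide int)
    show "integrable disc_area (\<lambda>z. norm (\<Sum>i\<in>B. z ^ i) * W (norm z))"
    proof (rule Bochner_Integration.integrable_bound[OF i2])
      show "(\<lambda>z. norm (\<Sum>i\<in>B. z ^ i) * W (norm z)) \<in> borel_measurable disc_area"
        by (intro borel_measurable_times radial_weight_norm_measurable[OF W]
            borel_measurable_disc_area borel_measurable_continuous_onI continuous_intros)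
      show "AE z in disc_area. norm (norm (\<Sum>i\<in>B. z ^ i) * W (norm z)) \<le> norm (?v z / 2)"
      proof (rule AE_I2)
        fix z assume z: "z \<in> space disc_area"
        have "0 \<le> norm (\<Sum>i\<in>B. z ^ i) * W (norm z)"
          using radial_weight_norm_nonneg[OF W z] by simp
        then show "norm (norm (\<Sum>i\<in>B. z ^ i) * W (norm z)) \<le> norm (?v z / 2)"
          using le[OF z] unfolding real_norm_def by linarith
      qed
    qed
  qed (rule le)
  also have "\<dots> = ((\<Sum>i\<in>D. 2 * moment W (2 * i + M + 1)) / s + s * (2 * moment W (M + 1))) / 2"
    using integral_norm_sum_sq[OF D, of M] integrable_norm_power_weight[OF W, of M] integral_norm_power_weight[OF W, of M]
    by (simp add: Bochner_Integration.integral_add)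
  also have "\<dots> \<le> ((\<Sum>i\<in>D. 2 * moment W (M + 1)) / s + s * (2 * moment W (M + 1))) / 2"
    using s by (intro divide_right_mono add_right_mono sum_mono mult_left_mono moment_antimono[OF W]) auto
  also have "\<dots> = (s * s) / s * moment W (M + 1) + s * moment W (M + 1)"
    unfolding s2 by (simp add: cD field_simps)
  also have "\<dots> = 2 * s * moment W (M + 1)" using s by simp
  finally show ?thesis by (simp add: s_def)
qed

text \<open>Pairing g with the polynomial gives at least 2 card B copies of the smallest moment,
  while the L-infinity against L1 bound grows only like sqrt(card B). The quotient sqrt(card B) is
  the gain.\<close>

lemma moments_le_of_projection_poly:
  assumes g: "g \<in> Linf" and B: "finite B" "B \<noteq> {}"
    and bounds: "\<And>i. i \<in> B \<Longrightarrow> M \<le> i" "\<And>i. i \<in> B \<Longrightarrow> i \<le> N"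
    and eq: "\<And>z. norm z < 1 \<Longrightarrow> Bergman_projection W g z = (\<Sum>i\<in>B. z ^ i)"
  shows "sqrt (card B) * moment W (2 * N + 1) \<le> Linf_norm g * moment W (M + 1)"
proof -
  define s where "s = sqrt (card B)"
  have s: "s > 0" using B by (simp add: s_def card_gt_0_iff)
  have s2: "s * s = card B" by (simp add: s_def)
  let ?f = "\<lambda>z::complex. \<Sum>i\<in>B. cnj z ^ i"
  have cont: "continuous_on UNIV ?f" by (intro continuous_intros)
  have bd: "norm (?f z) \<le> card B" if "norm z < 1" for z
    using sum_norm_le[of B "\<lambda>i. cnj z ^ i" "\<lambda>_. 1"] that
    by (simp add: norm_power power_le_one)
  have nf: "norm (?f z) = norm (\<Sum>i\<in>B. z ^ i)" for z
    by (subst complex_mod_cnj[symmetric]) (simp add: cnj_sum)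
  have "(LINT z|disc_area. g z * ?f z * of_real (W (norm z)))
      = (LINT z|disc_area. (\<Sum>i\<in>B. g z * cnj z ^ i * of_real (W (norm z))))"
    by (simp add: sum_distrib_left sum_distrib_right)
  also have "\<dots> = (\<Sum>i\<in>B. LINT z|disc_area. g z * cnj z ^ i * of_real (W (norm z)))"
  proof (rule Bochner_Integration.integral_sum)
    fix i
    show "integrable disc_area (\<lambda>z. g z * cnj z ^ i * of_real (W (norm z)))"
      by (rule integrable_Linf_times(1)[OF W g, where B = 1])
        (auto intro!: continuous_intros simp: norm_power power_le_one)
  qed
  also have "\<dots> = (\<Sum>i\<in>B. of_real (2 * moment W (2 * i + 1)))"
    using Bergman_projection_eq_poly_coeff[OF g B(1) eq] by (intro sum.cong) auto
  also have "\<dots> = of_real (\<Sum>i\<in>B. 2 * moment W (2 * i + 1))" by simp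
  finally have eq2: "(LINT z|disc_area. g z * ?f z * of_real (W (norm z))) = of_real (\<Sum>i\<in>B. 2 * moment W (2 * i + 1))" .
  have "2 * (s * s) * moment W (2 * N + 1) = (\<Sum>i\<in>B. 2 * moment W (2 * N + 1))"
    unfolding s2 by simp
  also have "\<dots> \<le> (\<Sum>i\<in>B. 2 * moment W (2 * i + 1))"
    using bounds by (intro sum_mono mult_left_mono moment_antimono[OF W]) auto
  also have "\<dots> = norm (LINT z|disc_area. g z * ?f z * of_real (W (norm z)))"
    unfolding eq2 norm_of_real
    using moment_pos[OF W] by (intro abs_of_nonneg[symmetric] sum_nonneg) (simp add: less_imp_le)
  also have "\<dots> \<le> (LINT z|disc_area. norm (g z * ?f z * of_real (W (norm z))))"
    by (rule integral_norm_bound)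
  also have "\<dots> \<le> Linf_norm g * (LINT z|disc_area. norm (?f z) * W (norm z))"
    by (rule integrable_Linf_times(2)[OF W g cont bd])
  also have "\<dots> \<le> Linf_norm g * (2 * s * moment W (M + 1))"
    using integral_norm_sum_le[OF B bounds(1)] Linf_norm_nonneg[OF g]
    unfolding nf s_def by (intro mult_left_mono) auto
  finally have "(2 * s) * (s * moment W (2 * N + 1)) \<le> (2 * s) * (Linf_norm g * moment W (M + 1))"
    by (simp add: mult_ac)
  then show ?thesis using s unfolding s_def by simp
qed

lemma Bloch_embedded_imp_moment_decay:
  assumes "Bloch_embedded_in_projection W"
  obtains C where "C > 0"
    "\<And>m n. n \<ge> 1 \<Longrightarrow> sqrt (real n) * moment W (2 ^ (m + n + 1) + 1) \<le> C * moment W (2 ^ (m + 1) + 1)"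
proof -
  obtain C where C: "C > 0" and E: "\<And>f. f \<in> Bloch \<Longrightarrow> \<exists>g\<in>Linf.
        (\<forall>z\<in>unit_disc. Bergman_projection W g z = f z) \<and> Linf_norm g \<le> C * Bloch_norm f"
    using assms unfolding Bloch_embedded_in_projection_def by blast
  have "sqrt (real n) * moment W (2 ^ (m + n + 1) + 1) \<le> (C * 4) * moment W (2 ^ (m + 1) + 1)"
    if n: "n \<ge> 1" for m n
  proof -
    \<comment> \<open>The window of exponents may sit anywhere: the Bloch norm stays below 4, so the
      constant is uniform in m and n.\<close>
    define B where "B = (\<lambda>k::nat. 2 ^ k :: nat) ` {m + 1..m + n}"
    define f where "f = (\<lambda>z::complex. \<Sum>i\<in>B. z ^ i)"
    have BK: "B \<subseteq> (\<lambda>k::nat. 2 ^ k) ` {1..m + n}" by (auto simp: B_def)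
    have card: "card B = n" unfolding B_def by (subst card_image) (auto simp: inj_on_def)
    have B: "finite B" "B \<noteq> {}" using n by (auto simp: B_def)
    have "f \<in> Bloch" "Bloch_norm f \<le> 4"
      unfolding f_def by (rule lacunary_Bloch[OF BK])+
    from E[OF this(1)] obtain g where g: "g \<in> Linf"
      "\<And>z. norm z < 1 \<Longrightarrow> Bergman_projection W g z = f z" "Linf_norm g \<le> C * Bloch_norm f" by auto
    have "sqrt (card B) * moment W (2 * 2 ^ (m + n) + 1) \<le> Linf_norm g * moment W (2 ^ (m + 1) + 1)"
    proof (rule moments_le_of_projection_poly[OF g(1) B])
      show "2 ^ (m + 1) \<le> i" if "i \<in> B" for i
        using that unfolding B_def by (force intro: power_increasing[of "m + 1" _ "2::nat"] simp del: power_Suc)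
      show "i \<le> 2 ^ (m + n)" if "i \<in> B" for i
        using that unfolding B_def by (auto intro!: power_increasing)
    qed (use g(2) in \<open>simp add: f_def\<close>)
    also have "\<dots> \<le> (C * 4) * moment W (2 ^ (m + 1) + 1)"
    proof (rule mult_right_mono)
      show "Linf_norm g \<le> C * 4"
        using g(3) \<open>Bloch_norm f \<le> 4\<close> C by (meson mult_left_mono less_imp_le order_trans)
    qed (use moment_pos[OF W] in \<open>simp add: less_imp_le\<close>)
    finally show ?thesis by (simp add: card)
  qed
  then show ?thesis using C by (intro that[of "C * 4"]) auto
qed

end

section \<open>Weights and dyadic tails\<close>

text \<open>The ratio of consecutive terms is C t^(2^l), which tends to 0: doubly exponential decay
  beats the growth C^l that upper doubling allows.\<close>

lemma summable_power_times_power_power2: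
  fixes t C :: real
  assumes t: "0 \<le> t" "t < 1" and C: "C \<ge> 0"
  shows "summable (\<lambda>l. C ^ l * t ^ (2 ^ l))"
proof -
  have "(\<lambda>n. t ^ n) \<longlonglongrightarrow> 0" using t by (intro LIMSEQ_realpow_zero) auto
  moreover have "strict_mono (\<lambda>l::nat. 2 ^ l :: nat)" by (simp add: strict_mono_def)
  ultimately have "((\<lambda>n. t ^ n) \<circ> (\<lambda>l. 2 ^ l)) \<longlonglongrightarrow> 0"
    by (rule LIMSEQ_subseq_LIMSEQ)
  then have "(\<lambda>l. t ^ (2 ^ l)) \<longlonglongrightarrow> 0"
    by (simp add: o_def)
  then have "(\<lambda>l. C * t ^ (2 ^ l)) \<longlonglongrightarrow> 0"
    by (rule tendsto_mult_right_zero)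
  then have "eventually (\<lambda>l. C * t ^ (2 ^ l) < 1 / 2) sequentially"
    by (rule order_tendstoD) simp
  then obtain N where N: "\<And>l. l \<ge> N \<Longrightarrow> C * t ^ (2 ^ l) < 1 / 2"
    by (auto simp: eventually_sequentially)
  show ?thesis
  proof (rule summable_ratio_test[of "1/2" N])
    fix l assume "l \<ge> N"
    have "C ^ Suc l * t ^ (2 ^ Suc l) = (C * t ^ (2 ^ l)) * (C ^ l * t ^ (2 ^ l))"
      by (simp add: power_add[symmetric] mult_2 mult_ac)
    also have "\<dots> \<le> 1 / 2 * (C ^ l * t ^ (2 ^ l))"
      using N[OF \<open>l \<ge> N\<close>] t C by (intro mult_right_mono) auto
    finally show "norm (C ^ Suc l * t ^ (2 ^ Suc l)) \<le> 1 / 2 * norm (C ^ l * t ^ (2 ^ l))"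
      using t C by simp
  qed simp
qed

text \<open>The radius at distance 2^-k from the circle. One application of upper doubling moves to
  the next index, and \<open>dyadic k ^ (2 ^ k)\<close> lies between 1/4 and 1/e for k >= 1, so
  r^(2^k) acts like a cutoff to radii beyond \<open>dyadic k\<close>.\<close>

definition dyadic :: "nat \<Rightarrow> real" where
  "dyadic k = 1 - (1 / 2) ^ k"

lemma dyadic_bounds: "0 \<le> dyadic k" "dyadic k < 1" "dyadic k \<in> {0..<1}" "dyadic k \<in> {0..1}"
  by (simp_all add: dyadic_def power_le_one)

lemma dyadic_0 [simp]: "dyadic 0 = 0"
  by (simp add: dyadic_def)

lemma dyadic_mono: "i \<le> j \<Longrightarrow> dyadic i \<le> dyadic j"
  by (simp add: dyadic_def power_decreasing)

lemma dyadic_Suc: "dyadic (Suc k) = (1 + dyadic k) / 2"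
  by (simp add: dyadic_def)

lemma filterlim_dyadic: "filterlim dyadic (at_left 1) sequentially"
proof -
  have "(\<lambda>k. 1 - (1 / 2) ^ k) \<longlonglongrightarrow> 1 - (0::real)"
    by (intro tendsto_intros LIMSEQ_realpow_zero) auto
  then have "dyadic \<longlonglongrightarrow> 1" by (simp add: dyadic_def[abs_def])
  then show ?thesis
    using dyadic_bounds(2) by (auto simp: filterlim_at less_imp_neq intro!: always_eventually)
qed

lemma dyadic_power_le: "dyadic k ^ (2 ^ (k + i)) \<le> exp (-1) ^ (2 ^ i)"
proof -
  have "dyadic k ^ (2 ^ k) \<le> exp (- ((1 / 2) ^ k)) ^ (2 ^ k)"
    using exp_ge_add_one_self[of "- ((1 / 2) ^ k)"] dyadic_bounds(1)[of k]
    by (intro power_mono) (auto simp: dyadic_def)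
  also have "\<dots> = exp (-1)"
    by (simp add: exp_of_nat_mult[symmetric] power_divide)
  finally show ?thesis
    using dyadic_bounds(1)[of k] by (simp add: power_add power_mult power_mono)
qed

text \<open>The index 0 is excluded because \<open>dyadic 0 = 0\<close>.\<close>

lemma dyadic_power_ge:
  assumes "k \<ge> 1"
  shows "(1 / 4) ^ (2 ^ i) \<le> dyadic k ^ (2 ^ (k + i))"
proof -
  obtain k' where k': "k = Suc k'" using assms by (cases k) auto
  have "1 / 4 \<le> dyadic k ^ (2 ^ k)"
    using power_one_minus_inverse_ge[of "2 ^ k'"] by (simp add: k' dyadic_def power_divide)
  then show ?thesis by (simp add: power_add power_mult power_mono)
qed

lemma dyadic_ge_half: "k \<ge> 1 \<Longrightarrow> dyadic k \<ge> 1 / 2"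
  using dyadic_mono[of 1 k] by (simp add: dyadic_def)

section \<open>Integrals over radial intervals, tails and moments\<close>

abbreviation Ico_integral :: "real \<Rightarrow> real \<Rightarrow> (real \<Rightarrow> real) \<Rightarrow> real" where
  "Ico_integral a b u \<equiv> (LINT r:{a..<b}|lebesgue. u r)"

lemma Ico_integral_split:
  assumes u: "set_integrable lebesgue {0..<1} u" and "0 \<le> a" "a \<le> b" "b \<le> c" "c \<le> 1"
  shows "Ico_integral a c u = Ico_integral a b u + Ico_integral b c u"
proof -
  have eq: "{a..<c} = {a..<b} \<union> {b..<c}" using assms by auto
  show ?thesis unfolding eq
    by (rule set_integral_Un) (use assms in \<open>auto intro!: set_integrable_subset[OF u]\<close>)
qed

lemma Ico_integral_mono:
  assumes u: "set_integrable lebesgue {0..<1} u" and v: "set_integrable lebesgue {0..<1} v"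
    and "0 \<le> a" "b \<le> 1" and "\<And>r. a \<le> r \<Longrightarrow> r < b \<Longrightarrow> u r \<le> v r"
  shows "Ico_integral a b u \<le> Ico_integral a b v"
  by (rule set_integral_mono)
     (use assms in \<open>auto intro!: set_integrable_subset[OF u] set_integrable_subset[OF v]\<close>)

lemma Ico_integral_nonneg:
  fixes u :: "real \<Rightarrow> real"
  assumes "\<And>r. a \<le> r \<Longrightarrow> r < b \<Longrightarrow> 0 \<le> u r"
  shows "0 \<le> Ico_integral a b u"
  unfolding set_lebesgue_integral_def using assms by (intro integral_nonneg_AE AE_I2) (auto simp: indicator_def)

lemma Ico_integral_mono_interval:
  assumes u: "set_integrable lebesgue {0..<1} u" and "\<And>r. r \<in> {0..<1} \<Longrightarrow> 0 \<le> u r"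
    and "0 \<le> a" "a \<le> a'" "b' \<le> b" "b \<le> 1" "a' \<le> b'"
  shows "Ico_integral a' b' u \<le> Ico_integral a b u"
proof -
  have "Ico_integral a b u = Ico_integral a a' u + (Ico_integral a' b' u + Ico_integral b' b u)"
    using assms by (subst Ico_integral_split[of u a a' b], simp_all)
      (subst Ico_integral_split[of u a' b' b], simp_all)
  moreover have "0 \<le> Ico_integral a a' u" "0 \<le> Ico_integral b' b u"
    using assms by (auto intro!: Ico_integral_nonneg)
  ultimately show ?thesis by linarith
qed

lemma weight_tail_antimono:
  assumes "radial_weight u" "0 \<le> a" "a \<le> b" "b < 1"
  shows "weight_tail u b \<le> weight_tail u a"
  unfolding weight_tail_def
  by (rule Ico_integral_mono_interval[OF radial_weight_integrable radial_weight_nonneg]) (use assms in auto)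

lemma D_hat_dyadic:
  assumes "w \<in> D_hat"
  obtains C where "C \<ge> 1" "\<And>i k. weight_tail w (dyadic i) \<le> C ^ k * weight_tail w (dyadic (i + k))"
proof -
  from assms obtain C where C: "C \<ge> 1" and d: "\<And>r. r \<in> {0..<1} \<Longrightarrow> weight_tail w r \<le> C * weight_tail w ((1 + r) / 2)"
    unfolding D_hat_def by blast
  have "weight_tail w (dyadic i) \<le> C ^ k * weight_tail w (dyadic (i + k))" for i k
  proof (induction k)
    case (Suc k)
    have "C ^ k * weight_tail w (dyadic (i + k)) \<le> C ^ k * (C * weight_tail w (dyadic (Suc (i + k))))"
      unfolding dyadic_Suc using C by (intro mult_left_mono d dyadic_bounds) auto
    with Suc.IH show ?case by (simp add: mult_ac)
  qed simp
  then show ?thesis using C that by blast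
qed

lemma D_check_dyadic:
  assumes "w \<in> D_check"
  obtains l q where "l \<ge> 1" "0 \<le> q" "q < 1" "\<And>k. weight_tail w (dyadic (k + l)) \<le> q * weight_tail w (dyadic k)"
proof -
  from assms obtain K C where w: "radial_weight w" and K: "K > 1" and C: "C > 1" and
    d: "\<And>r. r \<in> {0..<1} \<Longrightarrow> weight_tail w r \<ge> C * weight_tail w (1 - (1 - r) / K)"
    unfolding D_check_def by blast
  \<comment> \<open>With 2^l > K, l dyadic steps reach at least as far as one step of the lower
    doubling condition, and the tail decreases.\<close>
  obtain l where l: "K < 2 ^ l" using real_arch_pow[of 2 K] by auto
  have l1: "l \<ge> 1" using l K by (cases l) auto
  have "weight_tail w (dyadic (k + l)) \<le> 1 / C * weight_tail w (dyadic k)" for k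
  proof -
    have "weight_tail w (dyadic (k + l)) \<le> weight_tail w (1 - (1 - dyadic k) / K)"
    proof (rule weight_tail_antimono[OF w])
      have "(1 / 2) ^ k * (1 / 2) ^ l \<le> (1 / 2) ^ k * (1 / K)"
        using l K by (intro mult_left_mono) (auto simp: field_simps)
      then show "1 - (1 - dyadic k) / K \<le> dyadic (k + l)"
        by (simp add: dyadic_def power_add)
      have "(1 / 2) ^ k \<le> K" using K power_le_one[of "1/2::real" k] by linarith
      then show "0 \<le> 1 - (1 - dyadic k) / K"
        using K by (simp add: dyadic_def)
    qed (rule dyadic_bounds)
    also have "\<dots> \<le> 1 / C * weight_tail w (dyadic k)"
      using d[OF dyadic_bounds(3)[of k]] C by (simp add: field_simps)
    finally show ?thesis .
  qed
  then show ?thesis using l1 C by (intro that[of l "1 / C"]) auto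
qed

text \<open>On the ring from \<open>dyadic i\<close> to \<open>dyadic (Suc i)\<close> the power
  r^(2^k) is doubly exponentially small in k - i, whereas by upper doubling the tail from
  \<open>dyadic i\<close> exceeds the one from \<open>dyadic k\<close> by at most C^(k-i). The sum
  over the rings is bounded independently of k.\<close>

lemma D_hat_moment_le_tail:
  assumes "w \<in> D_hat"
  obtains B where "B > 0" "\<And>k. moment w (2 ^ k) \<le> B * weight_tail w (dyadic k)"
proof -
  have w: "radial_weight w" using assms by (simp add: D_hat_def)
  obtain C where C: "C \<ge> 1" and T: "\<And>i k. weight_tail w (dyadic i) \<le> C ^ k * weight_tail w (dyadic (i + k))"
    by (rule D_hat_dyadic[OF assms]) blast
  \<comment> \<open>The contribution of a ring whose outer radius has index k - l. The tail is taken
    from the inner radius, one step earlier, which costs the additional factor C below.\<close>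
  define a where "a l = C ^ l * exp (-1) ^ (2 ^ l)" for l
  have a: "summable a" unfolding a_def using C by (intro summable_power_times_power_power2) auto
  have a0: "a l \<ge> 0" for l using C by (simp add: a_def)
  have int: "set_integrable lebesgue {0..<1} (\<lambda>r. r ^ n * w r)" for n
    by (rule moment_integrable[OF w])
  have part: "Ico_integral 0 (dyadic k) (\<lambda>r. r ^ n * w r) \<le> (\<Sum>i<k. dyadic (Suc i) ^ n * weight_tail w (dyadic i))" for k n
  proof (induction k)
    case 0
    then show ?case by (simp add: set_lebesgue_integral_def)
  next
    case (Suc k)
    have "Ico_integral (dyadic k) (dyadic (Suc k)) (\<lambda>r. r ^ n * w r)
       \<le> Ico_integral (dyadic k) (dyadic (Suc k)) (\<lambda>r. dyadic (Suc k) ^ n * w r)"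
      using radial_weight_nonneg[OF w] dyadic_bounds[of k] dyadic_bounds[of "Suc k"]
      by (intro Ico_integral_mono int set_integrable_mult_right radial_weight_integrable[OF w])
         (auto intro!: mult_right_mono power_mono)
    also have "\<dots> = dyadic (Suc k) ^ n * Ico_integral (dyadic k) (dyadic (Suc k)) w"
      by simp
    also have "\<dots> \<le> dyadic (Suc k) ^ n * weight_tail w (dyadic k)"
      unfolding weight_tail_def using dyadic_bounds[of k] dyadic_bounds[of "Suc k"] dyadic_mono[of k "Suc k"]
      by (intro mult_left_mono Ico_integral_mono_interval[OF radial_weight_integrable[OF w] radial_weight_nonneg[OF w]]) auto
    finally show ?case
      using Suc.IH dyadic_bounds[of k] dyadic_bounds[of "Suc k"] dyadic_mono[of k "Suc k"]
      by (subst Ico_integral_split[OF int, of 0 "dyadic k"]) auto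
  qed
  have "moment w (2 ^ k) \<le> (C * suminf a + 1) * weight_tail w (dyadic k)" for k
  proof -
    have tpos: "weight_tail w (dyadic k) \<ge> 0" using weight_tail_pos[OF w dyadic_bounds(3)[of k]] by simp
    have "Ico_integral 0 (dyadic k) (\<lambda>r. r ^ (2 ^ k) * w r)
        \<le> (\<Sum>i<k. dyadic (Suc i) ^ (2 ^ k) * weight_tail w (dyadic i))" by (rule part)
    also have "\<dots> \<le> (\<Sum>i<k. (C * weight_tail w (dyadic k)) * a (k - Suc i))"
    proof (rule sum_mono)
      fix i assume "i \<in> {..<k}"
      then have i: "Suc i + (k - Suc i) = k" "i + Suc (k - Suc i) = k" by auto
      have "dyadic (Suc i) ^ (2 ^ k) \<le> exp (-1) ^ (2 ^ (k - Suc i))"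
        using dyadic_power_le[of "Suc i" "k - Suc i"] unfolding i .
      moreover have "weight_tail w (dyadic i) \<le> C ^ Suc (k - Suc i) * weight_tail w (dyadic k)"
        using T[of i "Suc (k - Suc i)"] unfolding i .
      ultimately have "dyadic (Suc i) ^ (2 ^ k) * weight_tail w (dyadic i)
          \<le> exp (-1) ^ (2 ^ (k - Suc i)) * (C ^ Suc (k - Suc i) * weight_tail w (dyadic k))"
        using weight_tail_pos[OF w dyadic_bounds(3)[of i]] by (intro mult_mono) auto
      then show "dyadic (Suc i) ^ (2 ^ k) * weight_tail w (dyadic i) \<le> (C * weight_tail w (dyadic k)) * a (k - Suc i)"
        by (simp add: a_def mult_ac)
    qed
    also have "\<dots> = (C * weight_tail w (dyadic k)) * (\<Sum>i<k. a i)"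
      by (simp only: sum_distrib_left[symmetric] sum.nat_diff_reindex)
    also have "\<dots> \<le> (C * weight_tail w (dyadic k)) * suminf a"
      using a a0 C tpos by (intro mult_left_mono sum_le_suminf) auto
    finally have 1: "Ico_integral 0 (dyadic k) (\<lambda>r. r ^ (2 ^ k) * w r) \<le> (C * weight_tail w (dyadic k)) * suminf a" .
    have "Ico_integral (dyadic k) 1 (\<lambda>r. r ^ (2 ^ k) * w r) \<le> Ico_integral (dyadic k) 1 w"
      using radial_weight_nonneg[OF w] dyadic_bounds[of k]
      by (intro Ico_integral_mono int radial_weight_integrable[OF w]) (auto intro!: mult_left_le_one_le power_le_one)
    then have 2: "Ico_integral (dyadic k) 1 (\<lambda>r. r ^ (2 ^ k) * w r) \<le> weight_tail w (dyadic k)"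
      by (simp add: weight_tail_def)
    have "moment w (2 ^ k) = Ico_integral 0 (dyadic k) (\<lambda>r. r ^ (2 ^ k) * w r) + Ico_integral (dyadic k) 1 (\<lambda>r. r ^ (2 ^ k) * w r)"
      unfolding moment_def using dyadic_bounds[of k] by (intro Ico_integral_split int) auto
    then show ?thesis using 1 2 by (simp add: algebra_simps)
  qed
  moreover have "C * suminf a + 1 > 0"
    using C suminf_nonneg[OF a a0] by (simp add: add_nonneg_pos)
  ultimately show ?thesis using that by blast
qed

lemma D_check_tail_tendsto_0:
  assumes "w \<in> D_check"
  shows "(\<lambda>k. weight_tail w (dyadic k)) \<longlonglongrightarrow> 0"
proof -
  have w: "radial_weight w" using assms by (simp add: D_check_def)
  obtain l q where l: "l \<ge> 1" and q: "0 \<le> q" "q < 1"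
    and T: "\<And>k. weight_tail w (dyadic (k + l)) \<le> q * weight_tail w (dyadic k)"
    by (rule D_check_dyadic[OF assms]) blast
  have dec: "weight_tail w (dyadic j) \<le> weight_tail w (dyadic i)" if "i \<le> j" for i j
    using weight_tail_antimono[OF w dyadic_bounds(1) dyadic_mono[OF that] dyadic_bounds(2)] .
  have it: "weight_tail w (dyadic (n * l)) \<le> q ^ n * weight_tail w (dyadic 0)" for n
  proof (induction n)
    case (Suc n)
    have "weight_tail w (dyadic (Suc n * l)) \<le> q * weight_tail w (dyadic (n * l))"
      using T[of "n * l"] by (simp add: add.commute)
    also have "\<dots> \<le> q * (q ^ n * weight_tail w (dyadic 0))"
      using q by (intro mult_left_mono Suc.IH) auto
    finally show ?case by simp
  qed simp
  show ?thesis
  proof (rule LIMSEQ_I)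
    fix e :: real assume e: "e > 0"
    have "(\<lambda>n. q ^ n * weight_tail w (dyadic 0)) \<longlonglongrightarrow> 0 * weight_tail w (dyadic 0)"
      using q by (intro tendsto_intros LIMSEQ_realpow_zero) auto
    then have "eventually (\<lambda>n. q ^ n * weight_tail w (dyadic 0) < e) sequentially"
      using e by (intro order_tendstoD(2)) auto
    then obtain n where n: "q ^ n * weight_tail w (dyadic 0) < e"
      by (auto simp: eventually_sequentially)
    have "norm (weight_tail w (dyadic k) - 0) < e" if "k \<ge> n * l" for k
      using dec[OF that] it[of n] n weight_tail_pos[OF w dyadic_bounds(3)[of k]] by simp
    then show "\<exists>no. \<forall>k\<ge>no. norm (weight_tail w (dyadic k) - 0) < e" by blast
  qed
qed

text \<open>Formulated for measurable profiles instead of radial weights, because the product of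
  \<omega> and \<phi> has vanishing tails if \<phi> is 0 near 1.\<close>

lemma Bergman_space_mono:
  assumes v: "set_borel_measurable lebesgue {0..<1} v"
    and le: "\<And>r. r \<in> {0..<1} \<Longrightarrow> \<bar>v r\<bar> \<le> c * \<bar>u r\<bar>"
  shows "Bergman_space p u \<subseteq> Bergman_space p v"
proof
  fix f assume "f \<in> Bergman_space p u"
  then have f: "f holomorphic_on unit_disc" and int: "integrable disc_area (\<lambda>z. norm (f z) powr p * u (norm z))"
    by (auto simp: Bergman_space_def)
  have "continuous_on unit_disc f" using f by (rule holomorphic_on_imp_continuous_on)
  then have "f \<in> borel_measurable (lebesgue_on unit_disc)"
    by (rule continuous_imp_measurable_on_sets_lebesgue) auto
  then have fm: "f \<in> borel_measurable disc_area" by (simp add: borel_measurable_disc_area_iff)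
  have vm: "(\<lambda>z. v (norm z)) \<in> borel_measurable disc_area" by (rule borel_measurable_radial[OF v])
  have "integrable disc_area (\<lambda>z. norm (f z) powr p * v (norm z))"
  proof (rule Bochner_Integration.integrable_bound)
    show "integrable disc_area (\<lambda>z. c * (norm (f z) powr p * u (norm z)))"
      by (intro integrable_mult_right int)
    show "(\<lambda>z. norm (f z) powr p * v (norm z)) \<in> borel_measurable disc_area"
      using fm vm by measurable
    show "AE z in disc_area. norm (norm (f z) powr p * v (norm z)) \<le> norm (c * (norm (f z) powr p * u (norm z)))"
    proof (rule AE_I2)
      fix z assume "z \<in> space disc_area"
      then have "\<bar>v (norm z)\<bar> \<le> c * \<bar>u (norm z)\<bar>" by (intro le) (auto simp: space_disc_area)
      also have "\<dots> \<le> \<bar>c\<bar> * \<bar>u (norm z)\<bar>" by (intro mult_right_mono) auto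
      finally have "norm (f z) powr p * \<bar>v (norm z)\<bar> \<le> norm (f z) powr p * (\<bar>c\<bar> * \<bar>u (norm z)\<bar>)"
        by (intro mult_left_mono) auto
      then show "norm (norm (f z) powr p * v (norm z)) \<le> norm (c * (norm (f z) powr p * u (norm z)))"
        by (simp add: abs_mult mult_ac)
    qed
  qed
  with f show "f \<in> Bergman_space p v" by (simp add: Bergman_space_def)
qed

lemma antimono_on_set_borel_measurable:
  fixes \<phi> :: "real \<Rightarrow> real"
  assumes "antimono_on {0..1} \<phi>"
  shows "set_borel_measurable lebesgue {0..<1} \<phi>"
proof -
  have "mono_on {0..1} (\<lambda>r. - \<phi> r)"
    using assms by (auto simp: monotone_on_def)
  then have "(\<lambda>r. - \<phi> r) \<in> borel_measurable (restrict_space borel {0..1})"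
    by (rule borel_measurable_mono_on_fnc)
  then have "(\<lambda>r. - (- \<phi> r)) \<in> borel_measurable (restrict_space borel {0..1})"
    by (rule borel_measurable_uminus)
  then have "(\<lambda>r. indicator {0..1} r *\<^sub>R \<phi> r) \<in> borel_measurable borel"
    by (subst (asm) borel_measurable_restrict_space_iff) simp_all
  then have "(\<lambda>r. indicator {0..<1} r *\<^sub>R (indicator {0..1} r *\<^sub>R \<phi> r)) \<in> borel_measurable borel"
    by (rule borel_measurable_scaleR[rotated]) simp
  also have "(\<lambda>r. indicator {0..<1} r *\<^sub>R (indicator {0..1} r *\<^sub>R \<phi> r)) = (\<lambda>r. indicator {0..<1} r *\<^sub>R \<phi> r)"
    by (auto simp: indicator_def)
  finally show ?thesis
    unfolding set_borel_measurable_def by (intro measurable_completion) simp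
qed

section \<open>Multiplying a weight of class D by a regular decreasing function\<close>

text \<open>Since \<open>\<phi>'/\<phi> \<ge> -C/(1-t)\<close>, the quotient \<open>\<phi>(t) / (1-t)\<^sup>C\<close> is increasing.\<close>

lemma log_derivative_lower_bound:
  fixes \<phi> :: "real \<Rightarrow> real"
  assumes C: "C > 0" and \<phi>: "\<And>t. t \<in> {0..<1} \<Longrightarrow> \<phi> t > 0 \<and>
               (\<phi> has_real_derivative \<phi>' t) (at t within {0..<1}) \<and> - \<phi>' t / \<phi> t \<le> C / (1 - t)"
    and ab: "0 \<le> a" "a \<le> b" "b < 1"
  shows "((1 - b) / (1 - a)) powr C * \<phi> a \<le> \<phi> b"
proof -
  define h where "h t = ln (\<phi> t) - C * ln (1 - t)" for t
  have "h a \<le> h b"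
  proof (rule DERIV_nonneg_imp_increasing_open[OF ab(2)])
    have dh: "(h has_real_derivative (\<phi>' t / \<phi> t + C / (1 - t))) (at t within {0..<1})" if "t \<in> {0..<1}" for t
    proof -
      have "((\<lambda>t. ln (\<phi> t)) has_real_derivative (1 / \<phi> t * \<phi>' t)) (at t within {0..<1})"
        using \<phi>[OF that] by (intro DERIV_chain2[OF DERIV_ln_divide]) auto
      moreover have "((\<lambda>t. ln (1 - t)) has_real_derivative (1 / (1 - t) * (0 - 1))) (at t within {0..<1})"
        using that by (intro DERIV_chain2[OF DERIV_ln_divide] DERIV_diff DERIV_const DERIV_ident) auto
      ultimately have "(h has_real_derivative (1 / \<phi> t * \<phi>' t - C * (1 / (1 - t) * (0 - 1)))) (at t within {0..<1})"
        unfolding h_def by (intro DERIV_diff DERIV_cmult)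
      then show ?thesis by simp
    qed
    show "continuous_on {a..b} h"
    proof (rule continuous_on_subset)
      show "continuous_on {0..<1} h"
        unfolding continuous_on_eq_continuous_within by (intro ballI DERIV_continuous[OF dh])
    qed (use ab in auto)
    fix t assume t: "a < t" "t < b"
    \<comment> \<open>At 0 only a one-sided derivative is available; it yields continuity, and
      monotonicity needs derivatives at interior points only, where the restricted derivative is
      two-sided.\<close>
    then have t': "t \<in> {0<..<1}" using ab by auto
    have "(h has_real_derivative (\<phi>' t / \<phi> t + C / (1 - t))) (at t within {0<..<1})"
      by (rule DERIV_subset[OF dh]) (use t' in auto)
    then have "(h has_real_derivative (\<phi>' t / \<phi> t + C / (1 - t))) (at t)"
      using t' by (simp only: at_within_open[of t] open_greaterThanLessThan)
    moreover have "\<phi>' t / \<phi> t + C / (1 - t) \<ge> 0"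
    proof -
      have "- \<phi>' t / \<phi> t \<le> C / (1 - t)" using \<phi>[of t] t' by simp
      then show ?thesis by simp
    qed
    ultimately show "\<exists>y. DERIV h t :> y \<and> 0 \<le> y" by blast
  qed
  then have "ln (\<phi> a) + C * (ln (1 - b) - ln (1 - a)) \<le> ln (\<phi> b)"
    by (simp add: h_def algebra_simps)
  then have "exp (ln (\<phi> a) + C * (ln (1 - b) - ln (1 - a))) \<le> exp (ln (\<phi> b))"
    by (simp only: exp_le_cancel_iff)
  moreover have "((1 - b) / (1 - a)) powr C = exp (C * (ln (1 - b) - ln (1 - a)))"
    using ab by (simp only: powr_def ln_div) simp
  moreover have "exp (ln (\<phi> a)) = \<phi> a" "exp (ln (\<phi> b)) = \<phi> b"
    using \<phi>[of a] \<phi>[of b] ab by (auto intro: exp_ln)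
  ultimately show ?thesis
    by (simp only: exp_add mult.commute)
qed

text \<open>Lower doubling survives with the same constants because \<phi> decreases: it weighs the
  part before \<open>g r\<close> at least as much as the part behind. Upper doubling needs that
  \<phi> cannot collapse over a bounded hyperbolic distance, which the bound on the logarithmic
  derivative provides.\<close>

lemma D_class_times_regular:
  fixes \<phi> :: "real \<Rightarrow> real"
  assumes w: "w \<in> D_class" and anti: "antimono_on {0..1} \<phi>" and C: "C > 0"
    and \<phi>: "\<And>t. t \<in> {0..<1} \<Longrightarrow> \<phi> t > 0 \<and>
               (\<phi> has_real_derivative \<phi>' t) (at t within {0..<1}) \<and> - \<phi>' t / \<phi> t \<le> C / (1 - t)"
  shows "(\<lambda>r. \<phi> r * w r) \<in> D_class"
proof -
  let ?v = "\<lambda>r. \<phi> r * w r"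
  have wh: "w \<in> D_hat" and wc: "w \<in> D_check" using w by (auto simp: D_class_def)
  have rw: "radial_weight w" using wh by (simp add: D_hat_def)
  from wh obtain C1 where C1: "C1 \<ge> 1" "\<And>r. r \<in> {0..<1} \<Longrightarrow> weight_tail w r \<le> C1 * weight_tail w ((1 + r) / 2)"
    unfolding D_hat_def by blast
  from wc obtain K C2 where K: "K > 1" and C2: "C2 > 1" and
    d: "\<And>r. r \<in> {0..<1} \<Longrightarrow> weight_tail w r \<ge> C2 * weight_tail w (1 - (1 - r) / K)"
    unfolding D_check_def by blast
  have dec: "\<phi> s \<le> \<phi> r" if "0 \<le> r" "r \<le> s" "s \<le> 1" for r s
    using anti that by (auto simp: monotone_on_def)
  have wi: "set_integrable lebesgue {0..<1} w" by (rule radial_weight_integrable[OF rw])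
  have vi: "set_integrable lebesgue {0..<1} ?v"
  proof (rule set_integrable_lebesgue_mult_bounded[OF wi antimono_on_set_borel_measurable[OF anti]])
    show "\<bar>\<phi> r\<bar> \<le> \<phi> 0" if "r \<in> {0..<1}" for r
      using dec[of 0 r] \<phi>[OF that] that by auto
  qed simp
  have v0: "?v r \<ge> 0" if "r \<in> {0..<1}" for r
    using \<phi>[OF that] radial_weight_nonneg[OF rw that] by simp
  have up: "Ico_integral a b ?v \<le> \<phi> a * Ico_integral a b w" if "0 \<le> a" "b \<le> 1" for a b
  proof -
    have "Ico_integral a b ?v \<le> Ico_integral a b (\<lambda>r. \<phi> a * w r)"
      using that dec radial_weight_nonneg[OF rw] by (intro Ico_integral_mono vi set_integrable_mult_right wi) (auto intro!: mult_right_mono)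
    then show ?thesis by simp
  qed
  have low: "\<phi> b * Ico_integral a b w \<le> Ico_integral a b ?v" if "0 \<le> a" "b \<le> 1" for a b
  proof -
    have "Ico_integral a b (\<lambda>r. \<phi> b * w r) \<le> Ico_integral a b ?v"
      using that dec radial_weight_nonneg[OF rw] by (intro Ico_integral_mono vi set_integrable_mult_right wi) (auto intro!: mult_right_mono)
    then show ?thesis by simp
  qed
  define g where "g r = 1 - (1 - r) / K" for r
  have g: "r \<le> g r" "g r < 1" if "r \<in> {0..<1}" for r
  proof -
    have "(1 - r) / K \<le> 1 - r" using K that divide_left_mono[of 1 K "1 - r"] by simp
    then show "r \<le> g r" by (simp add: g_def)
    show "g r < 1" using K that by (simp add: g_def)
  qed
  have tail_split: "weight_tail u r = Ico_integral r (g r) u + weight_tail u (g r)"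
    if "r \<in> {0..<1}" "set_integrable lebesgue {0..<1} u" for r u
    unfolding weight_tail_def using g[OF that(1)] that by (intro Ico_integral_split) auto
  \<comment> \<open>Lower doubling read in two ways: the segment from r to \<open>g r\<close>
    carries a fixed share of the tail from r and a fixed multiple of the tail from
    \<open>g r\<close>.\<close>
  have seg: "(1 - 1 / C2) * weight_tail w r \<le> Ico_integral r (g r) w"
    "(C2 - 1) * weight_tail w (g r) \<le> Ico_integral r (g r) w" if "r \<in> {0..<1}" for r
    using tail_split[OF that wi] d[OF that] C2 unfolding g_def[symmetric] by (auto simp: field_simps)
  have vlow: "\<phi> (g r) * ((1 - 1 / C2) * weight_tail w r) \<le> weight_tail ?v r" if r: "r \<in> {0..<1}" for r
  proof -
    have gr: "g r \<in> {0..<1}" using g[OF r] r by auto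
    have "\<phi> (g r) * ((1 - 1 / C2) * weight_tail w r) \<le> \<phi> (g r) * Ico_integral r (g r) w"
      using \<phi>[OF gr] by (intro mult_left_mono seg(1)[OF r]) auto
    also have "\<dots> \<le> Ico_integral r (g r) ?v" using r gr by (intro low) auto
    also have "\<dots> \<le> weight_tail ?v r"
      unfolding weight_tail_def using r gr g[OF r] by (intro Ico_integral_mono_interval[OF vi v0]) auto
    finally show ?thesis .
  qed
  have pos: "weight_tail ?v r > 0" if r: "r \<in> {0..<1}" for r
  proof -
    have gr: "g r \<in> {0..<1}" using g[OF r] r by auto
    have "0 < \<phi> (g r) * ((1 - 1 / C2) * weight_tail w r)"
      using \<phi>[OF gr] C2 weight_tail_pos[OF rw r] by simp
    then show ?thesis using vlow[OF r] by linarith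
  qed
  have rv: "radial_weight ?v"
    unfolding radial_weight_def using vi v0 pos by blast
  have "?v \<in> D_check"
  proof -
    have "weight_tail ?v r \<ge> C2 * weight_tail ?v (1 - (1 - r) / K)" if r: "r \<in> {0..<1}" for r
    proof -
      have gr: "g r \<in> {0..<1}" using g[OF r] r by auto
      have "(C2 - 1) * weight_tail ?v (g r) \<le> (C2 - 1) * (\<phi> (g r) * weight_tail w (g r))"
        unfolding weight_tail_def using C2 gr by (intro mult_left_mono up) auto
      also have "\<dots> = \<phi> (g r) * ((C2 - 1) * weight_tail w (g r))" by simp
      also have "\<dots> \<le> \<phi> (g r) * Ico_integral r (g r) w"
        using \<phi>[OF gr] by (intro mult_left_mono seg(2)[OF r]) auto
      also have "\<dots> \<le> Ico_integral r (g r) ?v" using r gr by (intro low) auto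
      finally show ?thesis
        using tail_split[OF r vi] by (simp add: g_def algebra_simps)
    qed
    then show ?thesis unfolding D_check_def using rv K C2 by blast
  qed
  moreover have "?v \<in> D_hat"
  proof -
    \<comment> \<open>Three losses: C1 for moving the tail of \<open>w\<close> from r to s, the
      share 1 - 1 / C2 before \<open>g s\<close>, and (2 K)^C for \<phi> between r and
      \<open>g s\<close>, since 1 - \<open>g s\<close> is (1 - r) / (2 K).\<close>
    define c where "c = (1 / (2 * K)) powr C * (1 - 1 / C2) / C1"
    have c: "c > 0" using K C2 C1 by (simp add: c_def)
    have main: "c * weight_tail ?v r \<le> weight_tail ?v ((1 + r) / 2)" if r: "r \<in> {0..<1}" for r
    proof -
      define s where "s = (1 + r) / 2"
      have s: "s \<in> {0..<1}" "r \<le> s" using r by (auto simp: s_def)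
      have gs: "g s \<in> {0..<1}" "s \<le> g s" using g[OF s(1)] s by auto
      have "(1 - g s) / (1 - r) = 1 / (2 * K)"
        using r K by (simp add: g_def s_def field_simps)
      then have 1: "(1 / (2 * K)) powr C * \<phi> r \<le> \<phi> (g s)"
        using log_derivative_lower_bound[OF C \<phi>, of r "g s"] r s gs by auto
      have "c * weight_tail ?v r \<le> c * (\<phi> r * weight_tail w r)"
        unfolding weight_tail_def using c r by (intro mult_left_mono up) auto
      also have "\<dots> \<le> c * (\<phi> r * (C1 * weight_tail w s))"
        unfolding s_def using c \<phi>[OF r] by (intro mult_left_mono C1(2) r) auto
      also have "\<dots> = ((1 / (2 * K)) powr C * \<phi> r) * ((1 - 1 / C2) * weight_tail w s)"
        using C1(1) by (simp add: c_def)
      also have "\<dots> \<le> \<phi> (g s) * ((1 - 1 / C2) * weight_tail w s)"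
        using C2 weight_tail_pos[OF rw s(1)] by (intro mult_right_mono 1) auto
      also have "\<dots> \<le> weight_tail ?v s" by (rule vlow[OF s(1)])
      finally show ?thesis by (simp add: s_def)
    qed
    \<comment> \<open>The maximum meets the requirement of a constant at least 1.\<close>
    have "weight_tail ?v r \<le> max 1 (1 / c) * weight_tail ?v ((1 + r) / 2)" if r: "r \<in> {0..<1}" for r
    proof -
      have "weight_tail ?v r \<le> 1 / c * weight_tail ?v ((1 + r) / 2)"
        using main[OF r] c by (simp add: field_simps)
      also have "\<dots> \<le> max 1 (1 / c) * weight_tail ?v ((1 + r) / 2)"
        using pos[of "(1 + r) / 2"] r by (intro mult_right_mono) auto
      finally show ?thesis .
    qed
    then show ?thesis unfolding D_hat_def using rv by (auto intro!: exI[of _ "max 1 (1 / c)"])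
  qed
  ultimately show ?thesis by (simp add: D_class_def)
qed

section \<open>The annular weight\<close>

definition annuli :: "(nat \<Rightarrow> nat) \<Rightarrow> nat \<Rightarrow> real set" where
  "annuli \<kappa> l = (\<Union>j. {dyadic (\<kappa> j)..<dyadic (\<kappa> j + l)})"

definition annular_weight :: "(nat \<Rightarrow> nat) \<Rightarrow> nat \<Rightarrow> (real \<Rightarrow> real) \<Rightarrow> (real \<Rightarrow> real) \<Rightarrow> real \<Rightarrow> real" where
  "annular_weight \<kappa> l \<phi> w r = (indicator (annuli \<kappa> l) r + \<phi> r) * w r"

lemma notin_annuli:
  assumes sep: "\<And>j. \<kappa> j + l \<le> \<kappa> (Suc j)"
    and r: "dyadic (\<kappa> j + l) \<le> r" "r < dyadic (\<kappa> (Suc j))"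
  shows "r \<notin> annuli \<kappa> l"
proof
  assume "r \<in> annuli \<kappa> l"
  then obtain i where i: "dyadic (\<kappa> i) \<le> r" "r < dyadic (\<kappa> i + l)" by (auto simp: annuli_def)
  have mono: "\<kappa> a \<le> \<kappa> b" if "a \<le> b" for a b
    by (rule lift_Suc_mono_le[OF _ that]) (use sep in \<open>meson add_leD1\<close>)
  show False
  proof (cases "i \<le> j")
    case True
    then have "dyadic (\<kappa> i + l) \<le> dyadic (\<kappa> j + l)" by (intro dyadic_mono add_right_mono mono)
    then show False using i r by linarith
  next
    case False
    then have "dyadic (\<kappa> (Suc j)) \<le> dyadic (\<kappa> i)" by (intro dyadic_mono mono) auto
    then show False using i r by linarith
  qed
qed

text \<open>C and B carry upper doubling (tails and moments), q and l lower doubling; F bounds the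
  factor by which the new weight exceeds \<open>w\<close>.\<close>

locale annular_construction =
  fixes w \<phi> :: "real \<Rightarrow> real" and C B q F :: real and l :: nat
  assumes w: "radial_weight w"
    and anti: "antimono_on {0..1} \<phi>" and \<phi>_nonneg: "\<And>t. t \<in> {0..1} \<Longrightarrow> \<phi> t \<ge> 0"
    and F: "F = 1 + \<phi> 0"
    and C: "C \<ge> 1" "\<And>i k. weight_tail w (dyadic i) \<le> C ^ k * weight_tail w (dyadic (i + k))"
    and B: "B > 0" "\<And>k. moment w (2 ^ k) \<le> B * weight_tail w (dyadic k)"
    and q: "l \<ge> 1" "0 \<le> q" "q < 1" "\<And>k. weight_tail w (dyadic (k + l)) \<le> q * weight_tail w (dyadic k)"
begin

abbreviation T :: "nat \<Rightarrow> real" where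
  "T k \<equiv> weight_tail w (dyadic k)"

text \<open>The factors up to 1 - q give a lower bound for what annulus j contributes to the moment
  of order 2^(\<open>\<kappa> j\<close> + l + j) + 1, in units of \<open>T (\<kappa> j)\<close>;
  dividing by j + 1 makes anything of size \<open>\<epsilon> j * T (\<kappa> j)\<close> negligible
  against that moment.\<close>

definition \<epsilon> :: "nat \<Rightarrow> real" where
  "\<epsilon> j = (1 / 4) ^ (2 ^ (l + j)) * (1 / 2) * (1 - q) / (real j + 1)"

text \<open>The first entry cancels the loss B C^(j+1) in \<open>annular_moment_flat\<close>, the
  second makes the gap negligible in \<open>annular_moment_drop\<close>.\<close>

definition \<delta> :: "nat \<Rightarrow> real" where
  "\<delta> j = min (1 / (B * C ^ Suc j)) (\<epsilon> j)"

lemma \<epsilon>_pos: "\<epsilon> j > 0"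
  using q by (simp add: \<epsilon>_def)

lemma \<delta>_pos: "\<delta> j > 0"
  using \<epsilon>_pos[of j] B C by (simp add: \<delta>_def)

lemma T_pos: "T k > 0"
  by (rule weight_tail_pos[OF w dyadic_bounds(3)])

lemma T_antimono: "i \<le> j \<Longrightarrow> T j \<le> T i"
  by (rule weight_tail_antimono[OF w dyadic_bounds(1) dyadic_mono dyadic_bounds(2)])

lemma F_ge_1: "F \<ge> 1"
  using \<phi>_nonneg[of 0] by (simp add: F)

lemma \<phi>_antimono: "0 \<le> r \<Longrightarrow> r \<le> s \<Longrightarrow> s \<le> 1 \<Longrightarrow> \<phi> s \<le> \<phi> r"
  using anti by (auto simp: monotone_on_def)

text \<open>The bound on k keeps later subtractions of indices exact and drives the annuli to the
  circle. As \<phi> decreases, its bound at the inner radius holds in the whole gap behind.\<close>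

definition admissible :: "nat \<Rightarrow> nat \<Rightarrow> bool" where
  "admissible j k \<longleftrightarrow> j + 1 \<le> k \<and> \<phi> (dyadic k) \<le> \<delta> j"

text \<open>Besides separation: the mass from the next annulus onwards is negligible for the drop
  after annulus k, and everything up to the end of annulus k is invisible to the moment of order
  2^(k' - Suc j) used in front of annulus k'.\<close>

definition successor :: "nat \<Rightarrow> nat \<Rightarrow> nat \<Rightarrow> bool" where
  "successor j k k' \<longleftrightarrow> k + l \<le> k' \<and> F * T k' \<le> \<epsilon> j * T k \<and>
     F * T 0 * dyadic (k + l) ^ (2 ^ (k' - Suc j)) \<le> T k'"

text \<open>Each requirement on the next index holds for all large indices, so dependent choice
  applies.\<close>

lemma ex_admissible_sequence:
  assumes \<phi>0: "(\<phi> \<longlongrightarrow> 0) (at_left 1)" and T0: "T \<longlonglongrightarrow> 0"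
  shows "\<exists>\<kappa>. \<forall>j. admissible j (\<kappa> j) \<and> successor j (\<kappa> j) (\<kappa> (Suc j))"
proof (rule dependent_nat_choice)
  have lim: "(\<lambda>k. \<phi> (dyadic k)) \<longlonglongrightarrow> 0"
    by (rule filterlim_compose[OF \<phi>0 filterlim_dyadic])
  have ev1: "eventually (admissible j) sequentially" for j
  proof -
    have "eventually (\<lambda>k. \<phi> (dyadic k) < \<delta> j) sequentially"
      by (rule order_tendstoD(2)[OF lim \<delta>_pos])
    then show ?thesis
      using eventually_ge_at_top[of "j + 1"] by eventually_elim (simp add: admissible_def)
  qed
  show "\<exists>k. admissible 0 k"
    using ev1[of 0] by (auto simp: eventually_sequentially)
  fix k j
  have ev2: "eventually (\<lambda>k'. F * T k' \<le> \<epsilon> j * T k) sequentially"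
  proof -
    have "(\<lambda>k'. F * T k') \<longlonglongrightarrow> 0" by (rule tendsto_mult_right_zero[OF T0])
    moreover have "\<epsilon> j * T k > 0" using \<epsilon>_pos T_pos by simp
    ultimately have "eventually (\<lambda>k'. F * T k' < \<epsilon> j * T k) sequentially" by (rule order_tendstoD(2))
    then show ?thesis by eventually_elim simp
  qed
  \<comment> \<open>Upper doubling bounds \<open>T k'\<close> below by \<open>T 0\<close> / C^k',
    which loses against the doubly exponential decay of the power; the shift by \<open>Suc j\<close>
    costs only a constant.\<close>
  have ev3: "eventually (\<lambda>k'. F * T 0 * dyadic (k + l) ^ (2 ^ (k' - Suc j)) \<le> T k') sequentially"
  proof -
    let ?t = "dyadic (k + l)"
    have "(\<lambda>i. C ^ i * ?t ^ (2 ^ i)) \<longlonglongrightarrow> 0"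
      using C by (intro summable_LIMSEQ_zero summable_power_times_power_power2 dyadic_bounds) auto
    then have "(\<lambda>i. F * C ^ Suc j * (C ^ i * ?t ^ (2 ^ i))) \<longlonglongrightarrow> 0"
      by (rule tendsto_mult_right_zero)
    then have "eventually (\<lambda>i. F * C ^ Suc j * (C ^ i * ?t ^ (2 ^ i)) < 1) sequentially"
      by (rule order_tendstoD(2)) simp
    then obtain N where N: "\<And>i. i \<ge> N \<Longrightarrow> F * C ^ Suc j * (C ^ i * ?t ^ (2 ^ i)) < 1"
      by (auto simp: eventually_sequentially)
    have "F * T 0 * ?t ^ (2 ^ (k' - Suc j)) \<le> T k'" if k': "k' \<ge> N + Suc j" for k'
    proof -
      define i where "i = k' - Suc j"
      have i: "k' = Suc j + i" "i \<ge> N" using k' by (auto simp: i_def)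
      have "F * T 0 * ?t ^ (2 ^ i) \<le> F * (C ^ k' * T k') * ?t ^ (2 ^ i)"
        using C(2)[of 0 k'] F_ge_1 dyadic_bounds(1)[of "k + l"] by (intro mult_right_mono mult_left_mono) auto
      also have "\<dots> = (F * C ^ Suc j * (C ^ i * ?t ^ (2 ^ i))) * T k'"
        unfolding i(1) power_add by (simp only: mult_ac)
      also have "\<dots> \<le> 1 * T k'"
        using N[OF i(2)] T_pos[of k'] by (intro mult_right_mono) auto
      finally show ?thesis by (simp add: i_def)
    qed
    then show ?thesis by (auto simp: eventually_sequentially)
  qed
  have "eventually (\<lambda>k'. admissible (Suc j) k' \<and> successor j k k') sequentially"
    using ev1[of "Suc j"] ev2 ev3 eventually_ge_at_top[of "k + l"]
    by eventually_elim (simp add: successor_def)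
  then show "\<exists>k'. admissible (Suc j) k' \<and> successor j k k'"
    by (auto simp: eventually_sequentially)
qed

context
  fixes \<kappa> :: "nat \<Rightarrow> nat"
  assumes adm: "\<And>j. admissible j (\<kappa> j)" and succ: "\<And>j. successor j (\<kappa> j) (\<kappa> (Suc j))"
begin

abbreviation W :: "real \<Rightarrow> real" where
  "W \<equiv> annular_weight \<kappa> l \<phi> w"

lemma sep: "\<kappa> j + l \<le> \<kappa> (Suc j)"
  using succ by (simp add: successor_def)

lemma indicator_annuli_borel: "indicator (annuli \<kappa> l) \<in> borel_measurable (borel :: real measure)"
  unfolding annuli_def by (intro borel_measurable_indicator sets.countable_UN) auto

lemma
  assumes "r \<in> {0..<1}"
  shows annular_weight_le: "W r \<le> F * w r"
    and annular_weight_ge: "\<phi> r * w r \<le> W r"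
    and annular_weight_nonneg: "0 \<le> W r"
proof -
  have w0: "0 \<le> w r" by (rule radial_weight_nonneg[OF w assms])
  have p: "0 \<le> \<phi> r" "\<phi> r \<le> \<phi> 0" using assms \<phi>_nonneg[of r] \<phi>_antimono[of 0 r] by auto
  have i: "0 \<le> (indicator (annuli \<kappa> l) r :: real)" "indicator (annuli \<kappa> l) r \<le> (1::real)"
    by (auto simp: indicator_def)
  have "indicator (annuli \<kappa> l) r + \<phi> r \<le> 1 + \<phi> 0"
    using p i by linarith
  then show "W r \<le> F * w r"
    unfolding annular_weight_def F by (rule mult_right_mono[OF _ w0])
  show "\<phi> r * w r \<le> W r"
    unfolding annular_weight_def using w0 p i by (intro mult_right_mono) auto
  show "0 \<le> W r"
    unfolding annular_weight_def using w0 p i by auto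
qed

lemma annular_weight_on_annulus:
  assumes "dyadic (\<kappa> j) \<le> r" "r < dyadic (\<kappa> j + l)"
  shows "w r \<le> W r"
proof -
  have r: "r \<in> {0..<1}" using assms dyadic_bounds[of "\<kappa> j"] dyadic_bounds[of "\<kappa> j + l"] by auto
  have "r \<in> annuli \<kappa> l" using assms by (auto simp: annuli_def)
  then have "W r = (1 + \<phi> r) * w r" by (simp add: annular_weight_def)
  then show ?thesis
    using radial_weight_nonneg[OF w r] \<phi>_nonneg[of r] r by (simp add: distrib_right)
qed

lemma annular_weight_in_gap:
  assumes "dyadic (\<kappa> j + l) \<le> r" "r < dyadic (\<kappa> (Suc j))"
  shows "W r \<le> \<delta> j * w r"
proof -
  have r: "r \<in> {0..<1}"
    using assms dyadic_bounds[of "\<kappa> j + l"] dyadic_bounds[of "\<kappa> (Suc j)"] by auto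
  have "W r = \<phi> r * w r"
    using notin_annuli[OF sep assms] by (simp add: annular_weight_def)
  also have "\<phi> r \<le> \<phi> (dyadic (\<kappa> j))"
    using assms(1) dyadic_mono[of "\<kappa> j" "\<kappa> j + l"] r by (intro \<phi>_antimono dyadic_bounds) auto
  also have "\<dots> \<le> \<delta> j" using adm by (simp add: admissible_def)
  finally show ?thesis
    using radial_weight_nonneg[OF w r] by (auto intro: mult_right_mono)
qed

lemma annular_weight_integrable: "set_integrable lebesgue {0..<1} W"
  unfolding annular_weight_def[abs_def]
proof (rule set_integrable_lebesgue_mult_bounded[OF radial_weight_integrable[OF w]])
  have "(\<lambda>r. indicator {0..<1} r *\<^sub>R \<phi> r) \<in> borel_measurable lebesgue"
    using antimono_on_set_borel_measurable[OF anti] by (simp add: set_borel_measurable_def)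
  moreover have "(\<lambda>r. indicator {0..<1} r * indicator (annuli \<kappa> l) r :: real) \<in> borel_measurable lebesgue"
    using indicator_annuli_borel by (intro measurable_completion borel_measurable_times) auto
  ultimately have "(\<lambda>r. indicator {0..<1} r * indicator (annuli \<kappa> l) r + indicator {0..<1} r *\<^sub>R \<phi> r) \<in> borel_measurable lebesgue"
    by (intro borel_measurable_add)
  then show "set_borel_measurable lebesgue {0..<1} (\<lambda>r. indicator (annuli \<kappa> l) r + \<phi> r)"
    by (simp add: set_borel_measurable_def algebra_simps)
  show "\<bar>indicator (annuli \<kappa> l) r + \<phi> r\<bar> \<le> F" if "r \<in> {0..<1}" for r
    using that \<phi>_nonneg[of r] \<phi>_antimono[of 0 r] by (auto simp: F indicator_def)
qed simp

text \<open>After l steps the tail has fallen to at most the fraction q, so the rest lies in the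
  annulus.\<close>

lemma annulus_mass: "(1 - q) * T (\<kappa> j) \<le> Ico_integral (dyadic (\<kappa> j)) (dyadic (\<kappa> j + l)) w"
proof -
  have "T (\<kappa> j) = Ico_integral (dyadic (\<kappa> j)) (dyadic (\<kappa> j + l)) w + T (\<kappa> j + l)"
    unfolding weight_tail_def
    using dyadic_bounds[of "\<kappa> j"] dyadic_bounds[of "\<kappa> j + l"] dyadic_mono[of "\<kappa> j" "\<kappa> j + l"]
    by (intro Ico_integral_split radial_weight_integrable[OF w]) auto
  then show ?thesis using q(4)[of "\<kappa> j"] by (simp add: algebra_simps)
qed

lemma annular_weight_tail_ge: "(1 - q) * T (\<kappa> j) \<le> weight_tail W (dyadic (\<kappa> j))"
proof -
  have "Ico_integral (dyadic (\<kappa> j)) (dyadic (\<kappa> j + l)) w \<le> Ico_integral (dyadic (\<kappa> j)) (dyadic (\<kappa> j + l)) W"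
    using dyadic_bounds[of "\<kappa> j"] dyadic_bounds[of "\<kappa> j + l"]
    by (intro Ico_integral_mono radial_weight_integrable[OF w] annular_weight_integrable annular_weight_on_annulus[of j]) auto
  also have "\<dots> \<le> weight_tail W (dyadic (\<kappa> j))"
    unfolding weight_tail_def
    using dyadic_bounds[of "\<kappa> j"] dyadic_bounds[of "\<kappa> j + l"] dyadic_mono[of "\<kappa> j" "\<kappa> j + l"]
    by (intro Ico_integral_mono_interval[OF annular_weight_integrable annular_weight_nonneg]) auto
  finally show ?thesis using annulus_mass[of j] by linarith
qed

text \<open>Positive tails come from the annuli, as \<phi> may vanish near 1: beyond every radius
  there is a complete annulus.\<close>

lemma radial_weight_annular: "radial_weight W"
proof -
  have "weight_tail W r > 0" if r: "r \<in> {0..<1}" for r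
  proof -
    have "(\<lambda>k. dyadic k) \<longlonglongrightarrow> 1"
      using filterlim_dyadic by (simp add: filterlim_at)
    then have "eventually (\<lambda>k. r < dyadic k) sequentially"
      using r by (intro order_tendstoD(1)) auto
    then obtain N where N: "\<And>k. k \<ge> N \<Longrightarrow> r < dyadic k" by (auto simp: eventually_sequentially)
    have k: "r < dyadic (\<kappa> N)" using adm[of N] by (intro N) (auto simp: admissible_def)
    have "0 < (1 - q) * T (\<kappa> N)" using q T_pos by simp
    also have "\<dots> \<le> weight_tail W (dyadic (\<kappa> N))" by (rule annular_weight_tail_ge)
    also have "\<dots> \<le> weight_tail W r"
      unfolding weight_tail_def using r k dyadic_bounds[of "\<kappa> N"]
      by (intro Ico_integral_mono_interval[OF annular_weight_integrable annular_weight_nonneg]) auto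
    finally show ?thesis .
  qed
  then show ?thesis
    unfolding radial_weight_def using annular_weight_integrable annular_weight_nonneg by blast
qed

section \<open>Moments of the annular weight behind and in front of an annulus\<close>

lemma annular_moment_integrable: "set_integrable lebesgue {0..<1} (\<lambda>r. r ^ n * W r)"
  by (rule moment_integrable[OF radial_weight_annular])

lemma annular_moment_split:
  assumes "0 \<le> a" "a \<le> b" "b \<le> 1"
  shows "moment W n = Ico_integral 0 a (\<lambda>r. r ^ n * W r) + Ico_integral a b (\<lambda>r. r ^ n * W r) + Ico_integral b 1 (\<lambda>r. r ^ n * W r)"
  unfolding moment_def using assms
  by (subst Ico_integral_split[OF annular_moment_integrable, of 0 a 1], simp_all)
     (subst Ico_integral_split[OF annular_moment_integrable, of a b 1], simp_all)

lemma Ico_integral_le_tail: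
  assumes "0 \<le> a" "a \<le> b" "b \<le> 1" "a < 1"
  shows "Ico_integral a b w \<le> weight_tail w a"
  unfolding weight_tail_def using assms
  by (intro Ico_integral_mono_interval[OF radial_weight_integrable[OF w] radial_weight_nonneg[OF w]]) auto

text \<open>Beyond the annulus, up to the next one, \<open>W\<close> is negligible.\<close>

lemma annular_moment_drop:
  defines "N \<equiv> \<lambda>j. 2 ^ (\<kappa> j + l + j)"
  shows "moment W (2 * N j + 1) \<le> 3 / (real j + 1) * moment W (N j + 1)"
proof -
  define a b c where "a = dyadic (\<kappa> j)" and "b = dyadic (\<kappa> j + l)" and "c = dyadic (\<kappa> (Suc j))"
  have abc: "0 \<le> a" "a \<le> b" "b \<le> c" "c < 1" "a < 1" "b < 1" "0 \<le> b"
    using sep[of j] by (auto simp: a_def b_def c_def intro!: dyadic_bounds dyadic_mono)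
  define X where "X = moment W (N j + 1)"
  have kj: "\<kappa> j \<ge> 1" using adm[of j] by (simp add: admissible_def)
  \<comment> \<open>The moment on the right is bounded below by annulus j alone; the definition of
    \<epsilon> is adapted to this estimate.\<close>
  have mass: "(real j + 1) * (\<epsilon> j * T (\<kappa> j)) \<le> X"
  proof -
    have "(1 / 4) ^ (2 ^ (l + j)) * (1 / 2) \<le> a ^ (2 ^ (\<kappa> j + (l + j))) * a"
      unfolding a_def using dyadic_power_ge[OF kj, of "l + j"] dyadic_ge_half[OF kj] dyadic_bounds(1)
      by (intro mult_mono) auto
    also have "\<dots> = a ^ (N j + 1)" by (simp add: N_def add.assoc)
    finally have e: "(1 / 4) ^ (2 ^ (l + j)) * (1 / 2) \<le> a ^ (N j + 1)" .
    have "(real j + 1) * (\<epsilon> j * T (\<kappa> j)) = ((real j + 1) * \<epsilon> j) * T (\<kappa> j)"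
      by simp
    also have "(real j + 1) * \<epsilon> j = (1 / 4) ^ (2 ^ (l + j)) * (1 / 2) * (1 - q)"
      unfolding \<epsilon>_def by (subst times_divide_eq_right) (rule nonzero_mult_div_cancel_left, linarith)
    also have "\<dots> * T (\<kappa> j) = ((1 / 4) ^ (2 ^ (l + j)) * (1 / 2)) * ((1 - q) * T (\<kappa> j))"
      by (simp only: mult.assoc)
    also have "\<dots> \<le> a ^ (N j + 1) * weight_tail W a"
      using e annular_weight_tail_ge[of j] q T_pos[of "\<kappa> j"] abc unfolding a_def[symmetric]
      by (intro mult_mono) auto
    also have "\<dots> \<le> X"
      unfolding X_def using abc by (intro moment_ge_tail[OF radial_weight_annular]) auto
    finally show ?thesis .
  qed
  \<comment> \<open>Up to the outer radius b, half of the exponent is spent on the factor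
    \<open>b ^ N j\<close>, at most exp(-2^j) because N j exceeds the scale of b by j steps; the
    other half reproduces the moment X.\<close>
  have "Ico_integral 0 b (\<lambda>r. r ^ (2 * N j + 1) * W r) \<le> Ico_integral 0 b (\<lambda>r. b ^ N j * (r ^ (N j + 1) * W r))"
  proof (intro Ico_integral_mono annular_moment_integrable set_integrable_mult_right)
    fix r assume r: "0 \<le> r" "r < b"
    have "r ^ N j * (r ^ (N j + 1) * W r) \<le> b ^ N j * (r ^ (N j + 1) * W r)"
      using r abc annular_weight_nonneg[of r] by (intro mult_right_mono power_mono) auto
    then show "r ^ (2 * N j + 1) * W r \<le> b ^ N j * (r ^ (N j + 1) * W r)"
      unfolding mult_2 power_add by (simp only: mult_ac)
  qed (use abc in auto)
  also have "\<dots> = b ^ N j * Ico_integral 0 b (\<lambda>r. r ^ (N j + 1) * W r)" by simp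
  also have "\<dots> \<le> b ^ N j * X"
    unfolding X_def moment_def using abc annular_weight_nonneg
    by (intro mult_left_mono Ico_integral_mono_interval annular_moment_integrable) auto
  also have "\<dots> \<le> 1 / (real j + 1) * X"
  proof (rule mult_right_mono)
    have "b ^ N j \<le> exp (-1) ^ (2 ^ j)"
      using dyadic_power_le[of "\<kappa> j + l" j] by (simp add: N_def b_def)
    also have "\<dots> = 1 / exp (real (2 ^ j))"
      by (simp add: exp_of_nat_mult[symmetric] exp_minus field_simps)
    also have "\<dots> \<le> 1 / (real j + 1)"
    proof (rule divide_left_mono)
      have "real j \<le> real (2 ^ j)" by (intro of_nat_mono less_imp_le less_exp)
      then show "real j + 1 \<le> exp (real (2 ^ j))"
        using exp_ge_add_one_self[of "real (2 ^ j)"] by linarith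
    qed auto
    finally show "b ^ N j \<le> 1 / (real j + 1)" .
    show "0 \<le> X" using moment_pos[OF radial_weight_annular] by (simp add: X_def less_imp_le)
  qed
  finally have 1: "Ico_integral 0 b (\<lambda>r. r ^ (2 * N j + 1) * W r) \<le> 1 / (real j + 1) * X" .
  have drop: "r ^ n * W r \<le> W r" if "0 \<le> r" "r < 1" for n r
    using that annular_weight_nonneg[of r] by (intro mult_left_le_one_le power_le_one) auto
  have "Ico_integral b c (\<lambda>r. r ^ (2 * N j + 1) * W r) \<le> Ico_integral b c (\<lambda>r. \<delta> j * w r)"
  proof (intro Ico_integral_mono annular_moment_integrable set_integrable_mult_right radial_weight_integrable[OF w])
    fix r assume r: "b \<le> r" "r < c"
    have "r ^ (2 * N j + 1) * W r \<le> W r" using r abc by (intro drop) auto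
    also have "\<dots> \<le> \<delta> j * w r" using r by (intro annular_weight_in_gap) (auto simp: b_def c_def)
    finally show "r ^ (2 * N j + 1) * W r \<le> \<delta> j * w r" .
  qed (use abc in auto)
  also have "\<dots> = \<delta> j * Ico_integral b c w" by simp
  also have "\<dots> \<le> \<epsilon> j * T (\<kappa> j)"
  proof (rule mult_mono)
    show "\<delta> j \<le> \<epsilon> j" by (simp add: \<delta>_def)
    have "Ico_integral b c w \<le> T (\<kappa> j + l)"
      using abc Ico_integral_le_tail[of b c] by (simp add: b_def)
    then show "Ico_integral b c w \<le> T (\<kappa> j)" using T_antimono[of "\<kappa> j" "\<kappa> j + l"] by simp
    show "0 \<le> Ico_integral b c w"
      using abc radial_weight_nonneg[OF w] by (intro Ico_integral_nonneg) auto
  qed (use \<epsilon>_pos[of j] in auto)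
  finally have 2: "Ico_integral b c (\<lambda>r. r ^ (2 * N j + 1) * W r) \<le> \<epsilon> j * T (\<kappa> j)" .
  have "Ico_integral c 1 (\<lambda>r. r ^ (2 * N j + 1) * W r) \<le> Ico_integral c 1 (\<lambda>r. F * w r)"
  proof (intro Ico_integral_mono annular_moment_integrable set_integrable_mult_right radial_weight_integrable[OF w])
    fix r assume r: "c \<le> r" "r < 1"
    have "r ^ (2 * N j + 1) * W r \<le> W r" using r abc by (intro drop) auto
    also have "\<dots> \<le> F * w r" using r abc by (intro annular_weight_le) auto
    finally show "r ^ (2 * N j + 1) * W r \<le> F * w r" .
  qed (use abc in auto)
  also have "\<dots> = F * T (\<kappa> (Suc j))" by (simp add: weight_tail_def c_def)
  also have "\<dots> \<le> \<epsilon> j * T (\<kappa> j)" using succ[of j] by (simp add: successor_def)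
  finally have 3: "Ico_integral c 1 (\<lambda>r. r ^ (2 * N j + 1) * W r) \<le> \<epsilon> j * T (\<kappa> j)" .
  \<comment> \<open>Now each of the three ranges is at most X / (j + 1).\<close>
  have "\<epsilon> j * T (\<kappa> j) \<le> 1 / (real j + 1) * X"
    using mass by (simp add: field_simps)
  then show ?thesis
    using annular_moment_split[of b c "2 * N j + 1"] 1 2 3 abc by (simp add: X_def)
qed

text \<open>Over the long gap preceding an annulus the moments hardly decrease.\<close>

lemma annular_moment_flat:
  shows "moment W (2 ^ (\<kappa> (Suc j) - Suc j) + 1) \<le> 8 * (2 / (1 - q) + 1) * moment W (2 ^ \<kappa> (Suc j) + 1)"
proof -
  define k where "k = \<kappa> (Suc j)"
  define x where "x = (2::nat) ^ (k - Suc j)"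
  define a t V where "a = dyadic k" and "t = dyadic (\<kappa> j + l)" and "V = weight_tail W a"
  have k: "Suc j \<le> k" "1 \<le> k" using adm[of "Suc j"] by (auto simp: admissible_def k_def)
  have at: "0 \<le> t" "t \<le> a" "a < 1" "0 \<le> a" "t < 1"
    using sep[of j] by (auto simp: a_def t_def k_def intro!: dyadic_bounds dyadic_mono)
  \<comment> \<open>Up to the end of the previous annulus only W <= F w is known; smallness comes
    from t^x through the last condition in \<open>successor\<close>.\<close>
  have "Ico_integral 0 t (\<lambda>r. r ^ (x + 1) * W r) \<le> Ico_integral 0 t (\<lambda>r. (F * t ^ x) * w r)"
  proof (intro Ico_integral_mono annular_moment_integrable set_integrable_mult_right radial_weight_integrable[OF w])
    fix r assume r: "0 \<le> r" "r < t"
    have "r ^ (x + 1) \<le> r ^ x" using r at by (intro power_decreasing) auto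
    also have "\<dots> \<le> t ^ x" using r by (intro power_mono) auto
    finally have "r ^ (x + 1) * W r \<le> t ^ x * (F * w r)"
      using r at by (intro mult_mono annular_weight_le annular_weight_nonneg) auto
    then show "r ^ (x + 1) * W r \<le> (F * t ^ x) * w r" by (simp add: mult_ac)
  qed (use at in auto)
  also have "\<dots> = F * t ^ x * Ico_integral 0 t w" by simp
  also have "\<dots> \<le> F * t ^ x * T 0"
    using at F_ge_1 Ico_integral_le_tail[of 0 t] by (intro mult_left_mono) auto
  also have "\<dots> \<le> T k"
    using succ[of j] by (simp add: successor_def x_def t_def k_def mult_ac)
  finally have 1: "Ico_integral 0 t (\<lambda>r. r ^ (x + 1) * W r) \<le> T k" .
  \<comment> \<open>In the gap, the moment of \<open>w\<close> of order x may exceed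
    \<open>T k\<close> by the factor B C^(j+1), and \<delta> removes exactly this.\<close>
  have "Ico_integral t a (\<lambda>r. r ^ (x + 1) * W r) \<le> Ico_integral t a (\<lambda>r. \<delta> j * (r ^ x * w r))"
  proof (intro Ico_integral_mono annular_moment_integrable set_integrable_mult_right moment_integrable[OF w])
    fix r assume r: "t \<le> r" "r < a"
    have "r ^ (x + 1) \<le> r ^ x" using r at by (intro power_decreasing) auto
    moreover have "W r \<le> \<delta> j * w r" using r by (intro annular_weight_in_gap) (auto simp: t_def a_def k_def)
    ultimately have "r ^ (x + 1) * W r \<le> r ^ x * (\<delta> j * w r)"
      using r at by (intro mult_mono annular_weight_nonneg) auto
    then show "r ^ (x + 1) * W r \<le> \<delta> j * (r ^ x * w r)" by (simp add: mult_ac)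
  qed (use at in auto)
  also have "\<dots> = \<delta> j * Ico_integral t a (\<lambda>r. r ^ x * w r)" by simp
  also have "\<dots> \<le> \<delta> j * moment w x"
    unfolding moment_def using at \<delta>_pos[of j] radial_weight_nonneg[OF w]
    by (intro mult_left_mono Ico_integral_mono_interval moment_integrable[OF w]) auto
  also have "\<dots> \<le> \<delta> j * (B * (C ^ Suc j * T k))"
  proof (intro mult_left_mono)
    have "moment w x \<le> B * T (k - Suc j)" unfolding x_def by (rule B(2))
    also have "\<dots> \<le> B * (C ^ Suc j * T k)"
      using C(2)[of "k - Suc j" "Suc j"] B(1) k(1) by (intro mult_left_mono) auto
    finally show "moment w x \<le> B * (C ^ Suc j * T k)" .
  qed (use \<delta>_pos[of j] in auto)
  also have "\<dots> \<le> 1 / (B * C ^ Suc j) * (B * (C ^ Suc j * T k))"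
  proof (rule mult_right_mono)
    show "\<delta> j \<le> 1 / (B * C ^ Suc j)" by (simp add: \<delta>_def)
  qed (use B(1) C(1) T_pos[of k] in auto)
  also have "\<dots> = T k" using B(1) C(1) by simp
  finally have 2: "Ico_integral t a (\<lambda>r. r ^ (x + 1) * W r) \<le> T k" .
  have 3: "Ico_integral a 1 (\<lambda>r. r ^ (x + 1) * W r) \<le> V"
    unfolding V_def weight_tail_def
  proof (intro Ico_integral_mono annular_moment_integrable annular_weight_integrable)
    fix r assume r: "a \<le> r" "r < 1"
    then show "r ^ (x + 1) * W r \<le> W r"
      using at by (intro mult_left_le_one_le power_le_one annular_weight_nonneg) auto
  qed (use at in auto)
  have TV: "T k \<le> V / (1 - q)"
    using annular_weight_tail_ge[of "Suc j"] q by (simp add: V_def a_def k_def field_simps)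
  have "moment W (x + 1) \<le> 2 * T k + V"
    using annular_moment_split[of t a "x + 1"] 1 2 3 at by simp
  also have "\<dots> \<le> (2 / (1 - q) + 1) * V"
  proof -
    have "2 * T k \<le> 2 * (V / (1 - q))" using TV by simp
    then show ?thesis by (simp add: distrib_right)
  qed
  \<comment> \<open>The 8 is 4 from \<open>a ^ (2 ^ k)\<close> times 2 from the odd factor a >=
    1/2.\<close>
  also have "\<dots> \<le> (2 / (1 - q) + 1) * (8 * moment W (2 ^ k + 1))"
  proof (rule mult_left_mono)
    have "(1 / 4) * (1 / 2) \<le> a ^ (2 ^ k) * a"
      unfolding a_def using dyadic_power_ge[OF k(2), of 0] dyadic_ge_half[OF k(2)] dyadic_bounds(1)
      by (intro mult_mono) auto
    then have "1 / 8 * V \<le> a ^ (2 ^ k + 1) * V"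
      using weight_tail_pos[OF radial_weight_annular, of a] at by (intro mult_right_mono) (auto simp: V_def mult.commute)
    also have "\<dots> \<le> moment W (2 ^ k + 1)"
      unfolding V_def using at by (intro moment_ge_tail[OF radial_weight_annular]) auto
    finally show "V \<le> 8 * moment W (2 ^ k + 1)" by simp
  qed (use q in auto)
  finally show ?thesis by (simp only: x_def k_def mult.assoc mult.left_commute)
qed

section \<open>Failure of boundedness and of the embedding\<close>

lemma not_projection_bounded_annular: "\<not> projection_bounded W"
proof
  assume "projection_bounded W"
  then obtain A where A: "A > 0" "\<And>k. k \<ge> 1 \<Longrightarrow> moment W (2 * k + 1) \<le> A * moment W (4 * k + 1)"
    using projection_bounded_imp_moment_doubling[OF radial_weight_annular] by blast
  obtain j :: nat where j: "3 * A < real j" using reals_Archimedean2 by blast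
  \<comment> \<open>Since l >= 1, the order M is even and the doubling inequality applies with M = 2
    k, k = 2^i.\<close>
  obtain i where i: "\<kappa> j + l + j = Suc i" using q(1) by (cases "\<kappa> j + l + j") auto
  define M where "M = (2::nat) ^ (\<kappa> j + l + j)"
  have M: "M = 2 * 2 ^ i" unfolding M_def i by simp
  have "moment W (M + 1) \<le> A * moment W (2 * M + 1)"
    using A(2)[of "2 ^ i"] by (simp add: M)
  also have "\<dots> \<le> A * (3 / (real j + 1) * moment W (M + 1))"
    using A(1) annular_moment_drop[of j] unfolding M_def by (intro mult_left_mono) auto
  also have "\<dots> = (3 * A / (real j + 1)) * moment W (M + 1)" by simp
  finally have "1 * moment W (M + 1) \<le> (3 * A / (real j + 1)) * moment W (M + 1)" by (simp only: mult_1)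
  then have "1 \<le> 3 * A / (real j + 1)"
    using moment_pos[OF radial_weight_annular, of "M + 1"] by (rule mult_right_le_imp_le)
  then show False using j by (simp add: field_simps)
qed

lemma not_Bloch_embedded_annular: "\<not> Bloch_embedded_in_projection W"
proof
  assume "Bloch_embedded_in_projection W"
  then obtain A where A: "A > 0" "\<And>m n. n \<ge> 1 \<Longrightarrow> sqrt (real n) * moment W (2 ^ (m + n + 1) + 1) \<le> A * moment W (2 ^ (m + 1) + 1)"
    using Bloch_embedded_imp_moment_decay[OF radial_weight_annular] by blast
  define D where "D = 8 * (2 / (1 - q) + 1)"
  obtain j :: nat where j: "(A * D)\<^sup>2 < real j" using reals_Archimedean2 by blast
  define k where "k = \<kappa> (Suc j)"
  \<comment> \<open>With n = j + 1 the decay inequality then compares the orders 2^k + 1 and 2^(k -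
    Suc j) + 1, exactly those of \<open>annular_moment_flat\<close>; admissibility makes the
    subtraction exact.\<close>
  define m where "m = k - Suc (Suc j)"
  have "Suc (Suc j) \<le> k" using adm[of "Suc j"] by (auto simp: admissible_def k_def)
  then have m: "m + Suc j + 1 = k" "m + 1 = k - Suc j" by (auto simp: m_def)
  have "sqrt (real (Suc j)) * moment W (2 ^ k + 1) \<le> A * moment W (2 ^ (k - Suc j) + 1)"
    using A(2)[of "Suc j" m] unfolding m by simp
  also have "\<dots> \<le> A * (D * moment W (2 ^ k + 1))"
    using A(1) annular_moment_flat[of j] unfolding k_def D_def by (intro mult_left_mono) auto
  finally have "sqrt (real (Suc j)) * moment W (2 ^ k + 1) \<le> (A * D) * moment W (2 ^ k + 1)" by simp
  then have "sqrt (real (Suc j)) \<le> A * D"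
    using moment_pos[OF radial_weight_annular, of "2 ^ k + 1"] by (rule mult_right_le_imp_le)
  then have "real (Suc j) \<le> (A * D)\<^sup>2" by (rule sqrt_le_D)
  then show False using j by simp
qed

end

end

theorem theorem15:
  fixes \<omega> \<phi> :: "real \<Rightarrow> real"
  assumes "\<omega> \<in> D_class"
    and "\<forall>t\<in>{0..1}. \<phi> t \<ge> 0"
    and "antimono_on {0..1} \<phi>"
    and "(\<phi> \<longlongrightarrow> 0) (at_left 1)"
  shows "(\<exists>W. radial_weight W \<and>
            \<not> projection_bounded W \<and>
            \<not> Bloch_embedded_in_projection W \<and>
            (\<forall>p>0. Bergman_space p \<omega> \<subseteq> Bergman_space p W \<and>
                   Bergman_space p W \<subseteq> Bergman_space p (\<lambda>r. \<omega> r * \<phi> r))) \<and>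
         ((\<exists>\<phi>' C. C > 0 \<and>
            (\<forall>t\<in>{0..<1}. \<phi> t > 0 \<and>
               (\<phi> has_real_derivative \<phi>' t) (at t within {0..<1}) \<and>
               - \<phi>' t / \<phi> t \<le> C / (1 - t)))
          \<longrightarrow> (\<lambda>r. \<phi> r * \<omega> r) \<in> D_class)"
proof (intro conjI impI)
  have wh: "\<omega> \<in> D_hat" and wc: "\<omega> \<in> D_check" using assms(1) by (auto simp: D_class_def)
  have w: "radial_weight \<omega>" using wh by (simp add: D_hat_def)
  obtain C where C: "C \<ge> 1" "\<And>i k. weight_tail \<omega> (dyadic i) \<le> C ^ k * weight_tail \<omega> (dyadic (i + k))"
    by (rule D_hat_dyadic[OF wh]) blast
  obtain B where B: "B > 0" "\<And>k. moment \<omega> (2 ^ k) \<le> B * weight_tail \<omega> (dyadic k)"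
    by (rule D_hat_moment_le_tail[OF wh]) blast
  obtain l q where q: "l \<ge> 1" "0 \<le> q" "q < 1" "\<And>k. weight_tail \<omega> (dyadic (k + l)) \<le> q * weight_tail \<omega> (dyadic k)"
    by (rule D_check_dyadic[OF wc]) blast
  interpret annular_construction \<omega> \<phi> C B q "1 + \<phi> 0" l
    by unfold_locales (use w assms(2,3) C B q in auto)
  obtain \<kappa> where \<kappa>: "\<And>j. admissible j (\<kappa> j)" "\<And>j. successor j (\<kappa> j) (\<kappa> (Suc j))"
    using ex_admissible_sequence[OF assms(4) D_check_tail_tendsto_0[OF wc]] by blast
  define W where "W = annular_weight \<kappa> l \<phi> \<omega>"
  have rW: "radial_weight W" unfolding W_def by (rule radial_weight_annular[OF \<kappa>])
  have W: "\<phi> r * \<omega> r \<le> W r" "W r \<le> (1 + \<phi> 0) * \<omega> r" "0 \<le> W r" "0 \<le> \<omega> r" "0 \<le> \<phi> r" if "r \<in> {0..<1}" for r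
    using annular_weight_ge[OF \<kappa> that] annular_weight_le[OF \<kappa> that] annular_weight_nonneg[OF \<kappa> that]
      radial_weight_nonneg[OF w that] assms(2) that by (auto simp: W_def)
  have m: "set_borel_measurable lebesgue {0..<1} (\<lambda>r. \<omega> r * \<phi> r)"
  proof -
    have "(\<lambda>r. (indicator {0..<1} r *\<^sub>R \<omega> r) * (indicator {0..<1} r *\<^sub>R \<phi> r)) \<in> borel_measurable lebesgue"
      using radial_weight_measurable[OF w] antimono_on_set_borel_measurable[OF assms(3)]
      unfolding set_borel_measurable_def by (rule borel_measurable_times)
    then show ?thesis
      unfolding set_borel_measurable_def
      by (rule back_subst[of "\<lambda>f. f \<in> borel_measurable lebesgue"]) (auto simp: indicator_def)
  qed
  have "Bergman_space p \<omega> \<subseteq> Bergman_space p W" for p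
    using W by (intro Bergman_space_mono[where c = "1 + \<phi> 0"] radial_weight_measurable[OF rW]) auto
  moreover have "Bergman_space p W \<subseteq> Bergman_space p (\<lambda>r. \<omega> r * \<phi> r)" for p
    using W by (intro Bergman_space_mono[where c = 1] m) (auto simp: mult.commute abs_mult)
  ultimately show "\<exists>W. radial_weight W \<and> \<not> projection_bounded W \<and> \<not> Bloch_embedded_in_projection W \<and>
      (\<forall>p>0. Bergman_space p \<omega> \<subseteq> Bergman_space p W \<and> Bergman_space p W \<subseteq> Bergman_space p (\<lambda>r. \<omega> r * \<phi> r))"
    using rW not_projection_bounded_annular[OF \<kappa>] not_Bloch_embedded_annular[OF \<kappa>]
    unfolding W_def by blast
next
  assume "\<exists>\<phi>' C. C > 0 \<and> (\<forall>t\<in>{0..<1}. \<phi> t > 0 \<and>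
               (\<phi> has_real_derivative \<phi>' t) (at t within {0..<1}) \<and> - \<phi>' t / \<phi> t \<le> C / (1 - t))"
  then obtain \<phi>' C where C: "C > 0" and \<phi>': "\<And>t. t \<in> {0..<1} \<Longrightarrow> \<phi> t > 0 \<and>
               (\<phi> has_real_derivative \<phi>' t) (at t within {0..<1}) \<and> - \<phi>' t / \<phi> t \<le> C / (1 - t)" by blast
  show "(\<lambda>r. \<phi> r * \<omega> r) \<in> D_class"
    by (rule D_class_times_regular[OF assms(1,3) C \<phi>'])
qed

end
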